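(* Let $m,n,r$ be positive integers with $r<\min\{m,n\}$, let $f:\mathbb{R}^{m\times n}\to\mathbb{R}$ be differentiable with locally Lipschitz continuous gradient, and let $0<\underline{\alpha}\le\overline{\alpha}<\infty$, $\beta,c\in(0,1)$, $\kappa_1\in(0,\frac12]$, $\kappa_2\in(0,1]$, $\Delta\in(0,\infty)$. Consider a sequence in $\mathbb{R}^{m\times n}_{\le r}$ generated by the $\mathrm{ERFDR}$ algorithm with these parameters from an arbitrary $X_0\in\mathbb{R}^{m\times n}_{\le r}$. If this sequence is finite, then its last element is B-stationary for the problem $\min_{X\in\mathbb{R}^{m\times n}_{\le r}}f(X)$. If it is infinite, then all of its accumulation points, if any, are B-stationary for this problem.
   Context: $\mathbb{R}^{m\times n}$ carries the Frobenius inner product $\langle X,Y\rangle=\operatorname{tr}(Y^\top X)$ and Frobenius norm $\|\cdot\|$. $\mathbb{R}^{m\times n}_{\le r}=\{X:\operatorname{rank}X\le r\}$, $\mathbb{R}^{m\times n}_{r-1}=\{X:\operatorname{rank}X=r-1\}$; $\sigma_1(X)\ge\dots\ge\sigma_{\min\{m,n\}}(X)\ge0$ are the singular values of $X$. Locally Lipschitz continuous gradient means: for every closed ball $\mathcal{B}\subsetneq\mathbb{R}^{m\times n}$, $\sup_{X,Y\in\mathcal{B},X\ne Y}\|\nabla f(X)-\nabla f(Y)\|/\|X-Y\|<\infty$. For nonempty $\mathcal{S}\subseteq\mathbb{R}^{m\times n}$, $P_{\mathcal{S}}(X)=\operatorname{argmin}_{Y\in\mathcal{S}}\|X-Y\|$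 (a set). Tangent cone: for $X\in\mathcal{S}$, $T_{\mathcal{S}}(X)$ is the set of all $Z$ for which there are sequences $(X_i)$ in $\mathcal{S}$ converging to $X$ and $(t_i)$ in $(0,\infty)$ with $(X_i-X)/t_i\to Z$. It is a closed cone. All elements of the projection of a given point onto a closed cone have the same norm. B-stationarity: $X\in\mathbb{R}^{m\times n}_{\le r}$ is B-stationary for $\min_{\mathbb{R}^{m\times n}_{\le r}}f$ if $\langle\nabla f(X),Z\rangle\ge0$ for all $Z\in T_{\mathbb{R}^{m\times n}_{\le r}}(X)$. Measure of B-stationarity: $\mathrm{s}(X;f,\mathbb{R}^{m\times n}_{\le r})$ is the common norm of the elements of $P_{T_{\mathbb{R}^{m\times n}_{\le r}}(X)}(-\nabla f(X))$. $\mathrm{ERFD}$ map with parameters $(f,r,\underline{\alpha},\overline{\alpha},\beta,c,\kappa_1,\kappa_2)$. Input $X\in\mathbb{R}^{m\times n}_{\le r}$. (1) Choose any $G\in\mathbb{R}^{m\times n}$ such that $\langle G,-\nabla f(X)\rangle\ge\max\{\kappa_1\,\mathrm{s}(X;f,\mathbb{R}^{m\times n}_{\le r})^2,\ \kappa_2\|G\|^2\}$ and $X+\alpha G\in\mathbb{R}^{m\times n}_{\le r}$ for all $\alpha\in[0,\overline{\alpha}]$. (2) Choose any $\alpha\in[\underline{\alpha},\overline{\alpha}]$. (3) While $f(X+\alpha G)>f(X)+c\,\alpha\langle\nabla f(X),G\rangle$, replace $\alpha$ by $\alpha\beta$. (4) Return $X+\alpha G$. The set of all possible outputs is $\mathrm{ERFD}(X;f,r,\underline{\alpha},\overline{\alpha},\beta,c,\kappa_1,\kappa_2)$.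 $\mathrm{ERFDR}$ map with the additional parameter $\Delta\in(0,\infty)$. Input $X\in\mathbb{R}^{m\times n}_{\le r}$. Choose $\tilde X\in\mathrm{ERFD}(X;f,r,\underline{\alpha},\overline{\alpha},\beta,c,\kappa_1,\kappa_2)$. If $\sigma_r(X)\in(0,\Delta]$, choose $\hat X\in P_{\mathbb{R}^{m\times n}_{r-1}}(X)$ and $\tilde X^{\mathrm R}\in\mathrm{ERFD}(\hat X;f,r,\underline{\alpha},\overline{\alpha},\beta,c,\kappa_1,\kappa_2)$, and return some $Y\in\operatorname{argmin}_{\{\tilde X,\tilde X^{\mathrm R}\}}f$; otherwise return $\tilde X$. The set of all possible outputs is $\mathrm{ERFDR}(X;f,r,\underline{\alpha},\overline{\alpha},\beta,c,\kappa_1,\kappa_2,\Delta)$. $\mathrm{ERFDR}$ algorithm. Starting from $X_0\in\mathbb{R}^{m\times n}_{\le r}$ and $i=0$: while $\mathrm{s}(X_i;f,\mathbb{R}^{m\times n}_{\le r})>0$, choose any $\Delta_i\in[\Delta,\infty)$, choose any $X_{i+1}\in\mathrm{ERFDR}(X_i;f,r,\underline{\alpha},\overline{\alpha},\beta,c,\kappa_1,\kappa_2,\Delta_i)$, and increment $i$. The generated sequence is finite if and only if the loop terminates. *)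

theory Defs
  imports
    "HOL-Analysis.Analysis"
    "HOL-Library.Extended_Nat"
    "HOL-Library.While_Combinator"
begin

text \<open>
  An \<open>m \<times> n\<close> matrix is an element of \<open>real ^ 'n ^ 'm\<close>, with \<open>m = CARD('m)\<close> and
  \<open>n = CARD('n)\<close>. The library's inner product and norm on this type are the Frobenius ones:
\<close>

lemma inner_eq_frobenius:
  fixes X Y :: "real ^ 'n ^ 'm"
  shows "X \<bullet> Y = trace (transpose Y ** X)"
  unfolding trace_def transpose_def matrix_matrix_mult_def inner_vec_def
  by (simp add: mult.commute) (rule sum.swap)

definition grad :: "('a::real_inner \<Rightarrow> real) \<Rightarrow> 'a \<Rightarrow> 'a" where
  "grad f X = (THE G. GDERIV f X :> G)"

definition locally_lipschitz_gradient :: "('a::real_inner \<Rightarrow> real) \<Rightarrow> bool" where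
  "locally_lipschitz_gradient f \<longleftrightarrow>
     (\<forall>A \<rho>. bdd_above {norm (grad f X - grad f Y) / norm (X - Y) | X Y.
                         X \<in> cball A \<rho> \<and> Y \<in> cball A \<rho> \<and> X \<noteq> Y})"

definition rank_le :: "nat \<Rightarrow> (real ^ 'n ^ 'm) set" where
  "rank_le r = {X. rank X \<le> r}"

definition rank_eq :: "nat \<Rightarrow> (real ^ 'n ^ 'm) set" where
  "rank_eq r = {X. rank X = r}"

definition eigenspace :: "real ^ 'n ^ 'n \<Rightarrow> real \<Rightarrow> (real ^ 'n) set" where
  "eigenspace A \<mu> = {v. A *v v = \<mu> *\<^sub>R v}"

definition eigenvalues :: "real ^ 'n ^ 'n \<Rightarrow> real set" where
  "eigenvalues A = {\<mu>. \<exists>v. v \<noteq> 0 \<and> v \<in> eigenspace A \<mu>}"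

text \<open>
  The singular values are the square roots of the eigenvalues of \<open>X\<^sup>T X\<close>, in decreasing order,
  each repeated according to its multiplicity. As \<open>X\<^sup>T X\<close> is symmetric, the multiplicity of an
  eigenvalue is the dimension of its eigenspace. Of the \<open>n\<close> numbers obtained, the first
  \<open>min m n\<close> are kept (the others are zero).
\<close>

definition singular_values :: "real ^ 'n ^ 'm \<Rightarrow> real list" where
  "singular_values X =
     (let A = transpose X ** X in
      take (min CARD('m) CARD('n))
        (concat (map (\<lambda>\<mu>. replicate (dim (eigenspace A \<mu>)) (sqrt \<mu>))
                     (rev (sorted_list_of_set (eigenvalues A))))))"

text \<open>Singular values are numbered from 1, list entries from 0.\<close>

definition sing_val :: "nat \<Rightarrow> real ^ 'n ^ 'm \<Rightarrow> real" where
  "sing_val k X = singular_values X ! (k - 1)"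

definition argmin_set :: "('a \<Rightarrow> real) \<Rightarrow> 'a set \<Rightarrow> 'a set" where
  "argmin_set h S = {Y. is_arg_min h (\<lambda>Z. Z \<in> S) Y}"

definition proj_set :: "'a::real_normed_vector set \<Rightarrow> 'a \<Rightarrow> 'a set" where
  "proj_set S X = argmin_set (\<lambda>Y. norm (X - Y)) S"

definition tangent_cone :: "'a::real_normed_vector set \<Rightarrow> 'a \<Rightarrow> 'a set" where
  "tangent_cone S X =
     {Z. \<exists>(x :: nat \<Rightarrow> 'a) (t :: nat \<Rightarrow> real).
           (\<forall>i. x i \<in> S) \<and> x \<longlonglongrightarrow> X \<and> (\<forall>i. t i > 0) \<and>
           (\<lambda>i. (x i - X) /\<^sub>R t i) \<longlonglongrightarrow> Z}"

definition B_stationary :: "(real ^ 'n ^ 'm \<Rightarrow> real) \<Rightarrow> nat \<Rightarrow> real ^ 'n ^ 'm \<Rightarrow> bool" where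
  "B_stationary f r X \<longleftrightarrow>
     X \<in> rank_le r \<and> (\<forall>Z \<in> tangent_cone (rank_le r) X. grad f X \<bullet> Z \<ge> 0)"

text \<open>
  All elements of the projection of a point onto a closed cone have the same norm, so the set of
  norms below is a singleton for \<open>X\<close> of rank at most \<open>r\<close>.
\<close>

definition stat_measure :: "(real ^ 'n ^ 'm \<Rightarrow> real) \<Rightarrow> nat \<Rightarrow> real ^ 'n ^ 'm \<Rightarrow> real" where
  "stat_measure f r X =
     the_elem (norm ` proj_set (tangent_cone (rank_le r) X) (- grad f X))"

text \<open>
  The set of all possible outputs. \<open>while_option\<close> returns \<open>Some \<alpha>\<close> exactly when the
  backtracking loop started at \<open>\<alpha>\<^sub>0\<close> terminates with the value \<open>\<alpha>\<close>.
\<close>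

definition ERFD ::
  "(real ^ 'n ^ 'm \<Rightarrow> real) \<Rightarrow> nat \<Rightarrow> real \<Rightarrow> real \<Rightarrow> real \<Rightarrow> real \<Rightarrow> real \<Rightarrow> real
     \<Rightarrow> real ^ 'n ^ 'm \<Rightarrow> (real ^ 'n ^ 'm) set" where
  "ERFD f r \<alpha>lo \<alpha>hi \<beta> c \<kappa>1 \<kappa>2 X =
     {X + \<alpha> *\<^sub>R G | \<alpha> G.
        G \<bullet> (- grad f X) \<ge> max (\<kappa>1 * (stat_measure f r X)\<^sup>2) (\<kappa>2 * (norm G)\<^sup>2) \<and>
        (\<forall>a \<in> {0..\<alpha>hi}. X + a *\<^sub>R G \<in> rank_le r) \<and>
        (\<exists>\<alpha>\<^sub>0 \<in> {\<alpha>lo..\<alpha>hi}.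
           while_option (\<lambda>a. f (X + a *\<^sub>R G) > f X + c * a * (grad f X \<bullet> G))
                        (\<lambda>a. a * \<beta>) \<alpha>\<^sub>0 = Some \<alpha>)}"

definition ERFDR ::
  "(real ^ 'n ^ 'm \<Rightarrow> real) \<Rightarrow> nat \<Rightarrow> real \<Rightarrow> real \<Rightarrow> real \<Rightarrow> real \<Rightarrow> real \<Rightarrow> real \<Rightarrow> real
     \<Rightarrow> real ^ 'n ^ 'm \<Rightarrow> (real ^ 'n ^ 'm) set" where
  "ERFDR f r \<alpha>lo \<alpha>hi \<beta> c \<kappa>1 \<kappa>2 \<Delta> X =
     {Y. \<exists>X' \<in> ERFD f r \<alpha>lo \<alpha>hi \<beta> c \<kappa>1 \<kappa>2 X.
           if sing_val r X \<in> {0<..\<Delta>}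
           then \<exists>Xhat \<in> proj_set (rank_eq (r - 1)) X.
                \<exists>XR \<in> ERFD f r \<alpha>lo \<alpha>hi \<beta> c \<kappa>1 \<kappa>2 Xhat.
                  Y \<in> argmin_set f {X', XR}
           else Y = X'}"

text \<open>
  \<open>ERFDR_sequence \<dots> N X\<close> states that the algorithm can generate the sequence
  \<open>X 0, X 1, \<dots>\<close> whose last index is \<open>N\<close>, where \<open>N = \<infinity>\<close> if the sequence is infinite.
  The values of \<open>X\<close> beyond \<open>N\<close> are irrelevant.
\<close>

definition ERFDR_sequence ::
  "(real ^ 'n ^ 'm \<Rightarrow> real) \<Rightarrow> nat \<Rightarrow> real \<Rightarrow> real \<Rightarrow> real \<Rightarrow> real \<Rightarrow> real \<Rightarrow> real \<Rightarrow> real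
     \<Rightarrow> enat \<Rightarrow> (nat \<Rightarrow> real ^ 'n ^ 'm) \<Rightarrow> bool" where
  "ERFDR_sequence f r \<alpha>lo \<alpha>hi \<beta> c \<kappa>1 \<kappa>2 \<Delta> N X \<longleftrightarrow>
     X 0 \<in> rank_le r \<and>
     (\<forall>i. enat i < N \<longrightarrow>
        stat_measure f r (X i) > 0 \<and>
        (\<exists>\<Delta>\<^sub>i \<ge> \<Delta>. X (Suc i) \<in> ERFDR f r \<alpha>lo \<alpha>hi \<beta> c \<kappa>1 \<kappa>2 \<Delta>\<^sub>i (X i))) \<and>
     (\<forall>k. N = enat k \<longrightarrow> \<not> stat_measure f r (X k) > 0)"

definition accumulation_point :: "(nat \<Rightarrow> 'a::topological_space) \<Rightarrow> 'a \<Rightarrow> bool" where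
  "accumulation_point x a \<longleftrightarrow> (\<exists>\<phi>. strict_mono \<phi> \<and> (x \<circ> \<phi>) \<longlonglongrightarrow> a)"

end

theory Submission
  imports Defs
begin

text \<open>
  Along the sequence the objective never increases, so \<open>f A \<le> f (X i)\<close> for each accumulation point
  \<open>A\<close> and each \<open>i\<close>. It is therefore enough that a point \<open>A\<close> of rank at most \<open>r\<close> that is not
  B-stationary repels the iteration: each step from a point of rank at most \<open>r\<close> close enough to \<open>A\<close>
  ends strictly below \<open>f A\<close> (\<open>ERFDR_escapes_nonstationary\<close>).

  Two estimates give this. Firstly, near \<open>A\<close> the backtracking stops at step sizes bounded away from
  zero, so an ERFD step from \<open>X\<close> decreases \<open>f\<close> by a fixed multiple of the squared stationarity measure
  at \<open>X\<close> (\<open>ERFD_sufficient_decrease\<close>). Secondly, that measure is bounded away from zero near \<open>A\<close>,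
  at the points where it has to be. As it dominates the slope of \<open>-f\<close> in every tangent direction
  (\<open>inner_le_stat_measure\<close>), it suffices to extend one descent direction at \<open>A\<close> to a continuous choice
  of tangent vectors.
  \<^item> If \<open>rank A = r\<close>, a tangent vector at \<open>A\<close> has the form \<open>C ** A + A ** B\<close>
    (\<open>tangent_maps_kernel_to_range\<close>, \<open>kernel_to_range_imp_two_sided\<close>), and \<open>C ** X + X ** B\<close> is tangent
    at every \<open>X\<close> of rank at most \<open>r\<close> (\<open>two_sided_in_tangent_cone\<close>).
  \<^item> If \<open>rank A < r\<close>, no such extension to nearby points of rank \<open>r\<close> need exist; there the measure
    can tend to zero although \<open>A\<close> is not stationary. This is what the rank reduction is for. Every rank-one
    matrix is tangent at every point of rank less than \<open>r\<close>, and some rank-one matrix is a descent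
    direction, as the gradient at \<open>A\<close> is not zero. Moreover a point \<open>X\<close> of rank \<open>r\<close> satisfies
    \<open>0 < sing_val r X\<close> and \<open>sing_val r X \<le> norm (X - A)\<close> (\<open>sing_val_pos\<close>, \<open>sing_val_le_dist_lower_rank\<close>).
    So near \<open>A\<close> the algorithm also tries a step from a projection of \<open>X\<close> onto the matrices of rank
    \<open>r - 1\<close>, which is close to \<open>A\<close> as well (\<open>rank_reduce_near\<close>).

  If the sequence is finite, the measure vanishes at its last element, and the slope bound says that
  no tangent direction there is a descent direction.
\<close>

section \<open>Rank and rank-one perturbations\<close>

lemma norm_matrix_vector_mult_le:
  fixes A :: "real ^ 'n ^ 'm"
  shows "norm (A *v x) \<le> norm A * norm x"
proof -
  have "norm (A *v x) \<le> L2_set (\<lambda>i. norm (A $ i) * norm x) UNIV"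
    unfolding norm_vec_def[of "A *v x"]
    by (rule L2_set_mono)
      (auto simp: matrix_mult_dot Cauchy_Schwarz_ineq2 simp del: norm_vec_def)
  also have "\<dots> = norm A * norm x"
    by (simp add: norm_vec_def[of A] L2_set_left_distrib)
  finally show ?thesis .
qed

text \<open>
  The rank-one matrix \<open>w v\<^sup>T\<close>, whose rows are multiples of \<open>v\<close>.
\<close>

definition outer :: "real ^ 'm \<Rightarrow> real ^ 'n \<Rightarrow> real ^ 'n ^ 'm" where
  "outer w v = (\<chi> i. (w $ i) *\<^sub>R v)"

lemma outer_mult_vec: "outer w v *v x = (v \<bullet> x) *\<^sub>R w"
  by (simp add: outer_def vec_eq_iff matrix_mult_dot mult.commute)

lemma norm_outer: "norm (outer w v) = norm w * norm v"
  by (simp add: outer_def norm_vec_def[of "\<chi> i. (w $ i) *\<^sub>R v"] norm_vec_def[of w] L2_set_left_distrib)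

lemma rank_add_outer_le:
  fixes A :: "real ^ 'n ^ 'm"
  shows "rank (A + outer w v) \<le> rank A + 1"
proof -
  have "range ((*v) (A + outer w v)) \<subseteq> span (insert w (range ((*v) A)))"
    by (auto simp: matrix_vector_mult_add_rdistrib outer_mult_vec span_add span_base span_scale)
  then have "rank (A + outer w v) \<le> dim (insert w (range ((*v) A)))"
    unfolding rank_dim_range by (metis dim_span dim_subset)
  also have "\<dots> \<le> rank A + 1"
    by (simp add: rank_dim_range dim_insert)
  finally show ?thesis .
qed

text \<open>
  If \<open>A\<close> were injective on \<open>V\<close>, its range would have dimension at least \<open>dim V\<close>. All comparisons
  of two matrices of different rank below start from such a vector: it is in the kernel of one
  matrix and in a subspace on which the other one is controlled.
\<close>

lemma rank_less_imp_kernel_vector: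
  fixes A :: "real ^ 'n ^ 'm" and V :: "(real ^ 'n) set"
  assumes "subspace V" and "rank A < dim V"
  obtains v where "v \<in> V" "v \<noteq> 0" "A *v v = 0"
proof (cases "inj_on ((*v) A) V")
  case True
  then have "dim ((*v) A ` V) = dim V"
    using assms(1) by (intro dim_image_eq matrix_vector_mul_linear) (metis span_eq_iff)
  moreover have "dim ((*v) A ` V) \<le> rank A"
    unfolding rank_dim_range by (intro dim_subset) auto
  ultimately show ?thesis using assms by simp
next
  case False
  then obtain x y where "x \<in> V" "y \<in> V" "x \<noteq> y" "A *v x = A *v y"
    by (auto simp: inj_on_def)
  with assms(1) show ?thesis
    by (intro that[of "x - y"]) (auto simp: subspace_diff matrix_vector_mult_diff_distrib)
qed

text \<open>
  The complement is open: \<open>A\<close> is bounded below by some \<open>e\<close> on its row space, and a matrix of smaller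
  rank kills a vector of that space, so it has distance at least \<open>e\<close> from \<open>A\<close>.
\<close>

lemma closed_rank_le: "closed (rank_le k :: (real ^ 'n ^ 'm) set)"
proof -
  have "\<exists>e>0. \<forall>Y. dist Y A < e \<longrightarrow> Y \<in> - rank_le k" if "A \<in> - rank_le k" for A :: "real ^ 'n ^ 'm"
  proof -
    have "closed (span (rows A))" by (simp add: closed_subspace)
    moreover have "\<forall>x\<in>span (rows A). A *v x = 0 \<longrightarrow> x = 0"
      using nullspace_inter_rowspace by blast
    ultimately obtain e where e: "e > 0" "\<And>x. x \<in> span (rows A) \<Longrightarrow> norm (A *v x) \<ge> e * norm x"
      using injective_imp_isometric[of "span (rows A)" "(*v) A"]
      by (auto simp: matrix_vector_mul_bounded_linear)
    have "Y \<in> - rank_le k" if "dist Y A < e" for Y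
    proof (rule ccontr)
      assume "Y \<notin> - rank_le k"
      with \<open>A \<in> - rank_le k\<close> have "rank Y < dim (span (rows A))"
        by (simp add: rank_le_def row_rank_def)
      then obtain v where v: "v \<in> span (rows A)" "v \<noteq> 0" "Y *v v = 0"
        using rank_less_imp_kernel_vector[OF subspace_span] by blast
      have "e * norm v \<le> norm ((A - Y) *v v)"
        using e(2)[OF v(1)] v(3) by (simp add: matrix_vector_mult_diff_rdistrib)
      also have "\<dots> \<le> dist Y A * norm v"
        using norm_matrix_vector_mult_le by (simp add: dist_norm norm_minus_commute)
      finally show False using v(2) \<open>dist Y A < e\<close> by simp
    qed
    with e(1) show ?thesis by blast
  qed
  then have "open (- rank_le k :: (real ^ 'n ^ 'm) set)"
    unfolding open_dist by blast
  then show ?thesis by (simp add: closed_def)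
qed

text \<open>
  Some unit vector \<open>v\<close> of the row space of \<open>X\<close> is killed by \<open>A\<close>. Making \<open>X\<close> vanish on \<open>v\<close> lowers the
  rank by exactly one and costs only \<open>norm (X *v v) = norm ((X - A) *v v)\<close>. Hence a nearest matrix of
  rank \<open>rank X - 1\<close> is no farther from \<open>X\<close> than \<open>A\<close> is, even if \<open>A\<close> has a much smaller rank.
\<close>

lemma rank_reduce_near:
  fixes A X :: "real ^ 'n ^ 'm"
  assumes "rank A < rank X"
  obtains B where "rank B = rank X - 1" "norm (X - B) \<le> norm (X - A)"
proof -
  obtain u where u: "u \<in> span (rows X)" "u \<noteq> 0" "A *v u = 0"
    using rank_less_imp_kernel_vector[of "span (rows X)" A] assms
    by (auto simp: row_rank_def)
  define v where "v = u /\<^sub>R norm u"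
  have v: "v \<in> span (rows X)" "norm v = 1" "A *v v = 0"
    using u by (auto simp: v_def span_scale matrix_vector_mult_scaleR)
  then have vv: "v \<bullet> v = 1" by (simp add: norm_eq_1)
  define B where "B = X - outer (X *v v) v"
  have "X - B = outer ((X - A) *v v) v"
    using v by (simp add: B_def matrix_vector_mult_diff_rdistrib)
  then have "norm (X - B) \<le> norm (X - A)"
    using norm_matrix_vector_mult_le[of "X - A" v] v by (simp add: norm_outer)
  moreover have "rank X \<le> rank B + 1"
    using rank_add_outer_le[of B "X *v v" v] by (simp add: B_def)
  moreover have "rank B < rank X"
  proof -
    have "rows B \<subseteq> {y \<in> span (rows X). \<forall>x \<in> span {v}. orthogonal x y}"
    proof
      fix y assume "y \<in> rows B"
      then obtain i where i: "y = B $ i" by (auto simp: rows_def row_def)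
      have Bi: "B $ i = X $ i - (X $ i \<bullet> v) *\<^sub>R v"
        by (simp add: B_def outer_def matrix_mult_dot)
      have "X $ i \<in> span (rows X)"
        by (rule span_base) (auto simp: rows_def row_def)
      then have "y \<in> span (rows X)"
        unfolding i Bi by (intro span_diff span_scale v)
      moreover have "orthogonal x y" if "x \<in> span {v}" for x
        using that vv by (auto simp: span_singleton i Bi orthogonal_def inner_diff_right inner_commute)
      ultimately show "y \<in> {y \<in> span (rows X). \<forall>x \<in> span {v}. orthogonal x y}" by blast
    qed
    then have "rank B + dim (span {v}) \<le> dim {y \<in> span (rows X). \<forall>x \<in> span {v}. orthogonal x y} + dim (span {v})"
      unfolding row_rank_def by (intro add_right_mono dim_subset)
    also have "\<dots> = rank X"
      using v(1) unfolding row_rank_def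
      by (subst dim_subspace_orthogonal_to_vectors)
        (auto simp: span_minimal intro: span_minimal[THEN subsetD])
    finally show ?thesis
      using vv by (auto split: if_splits)
  qed
  ultimately show ?thesis by (intro that[of B]) linarith+
qed

section \<open>Matrices that map a kernel into a range\<close>

lemma generalized_inverse_exists:
  fixes A :: "real ^ 'n ^ 'm"
  obtains D :: "real ^ 'm ^ 'n" where "\<And>x. A *v (D *v (A *v x)) = A *v x"
proof -
  obtain g where "linear g" "\<forall>v \<in> range ((*v) A). A *v (g v) = v"
    using linear_exists_right_inverse_on[OF matrix_vector_mul_linear[of A] subspace_UNIV] by blast
  then show ?thesis
    by (intro that[of "matrix g"]) (simp add: matrix_works)
qed

text \<open>
  The matrices \<open>C ** A + A ** B\<close> are the tangent vectors at \<open>A\<close> to the manifold of matrices of rank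
  \<open>rank A\<close>. This form is used because it makes sense with any other matrix in place of \<open>A\<close>, which
  transports a tangent vector continuously to the nearby points.
\<close>

lemma kernel_to_range_imp_two_sided:
  fixes A Z :: "real ^ 'n ^ 'm"
  assumes "\<And>v. A *v v = 0 \<Longrightarrow> Z *v v \<in> range ((*v) A)"
  obtains C B where "Z = C ** A + A ** B"
proof -
  obtain D :: "real ^ 'm ^ 'n" where D: "\<And>x. A *v (D *v (A *v x)) = A *v x"
    using generalized_inverse_exists by blast
  define C where "C = (mat 1 - A ** D) ** (Z ** D)"
  have "Z *v x = C *v (A *v x) + A *v (D *v (Z *v x))" for x
  proof -
    \<comment> \<open>\<open>A ** D\<close> is a projection onto the range of \<open>A\<close>, and \<open>x - D *v (A *v x)\<close> is in the kernel of \<open>A\<close>,\<close>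
    \<comment> \<open>so the projection fixes the image of this vector under \<open>Z\<close>.\<close>
    let ?d = "x - D *v (A *v x)"
    have "A *v ?d = 0" by (simp add: matrix_vector_mult_diff_distrib D)
    then obtain y where y: "Z *v ?d = A *v y" using assms by blast
    have "Z *v ?d = A *v (D *v (Z *v ?d))" unfolding y by (simp add: D)
    then show ?thesis
      by (simp add: C_def matrix_vector_mult_diff_distrib matrix_vector_mult_diff_rdistrib
          flip: matrix_vector_mul_assoc) (simp add: algebra_simps)
  qed
  then have "Z = C ** A + A ** (D ** Z)"
    by (simp add: matrix_eq matrix_vector_mult_add_rdistrib flip: matrix_vector_mul_assoc)
  then show ?thesis by (rule that)
qed

section \<open>Decreasing lists\<close>

lemma decreasing_nth_of_filter:
  fixes L :: "'a::linorder list"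
  assumes "sorted_wrt (\<ge>) L" and "\<And>x y. P x \<Longrightarrow> x \<le> y \<Longrightarrow> P y"
    and "k < length (filter P L)"
  shows "P (L ! k)"
proof (rule ccontr)
  assume k: "\<not> P (L ! k)"
  have "k < length L"
    using assms(3) length_filter_le[of P L] by linarith
  have "filter P (drop k L) = []"
  proof -
    have "\<not> P x" if x: "x \<in> set (drop k L)" for x
    proof -
      obtain i where i: "i < length L - k" "x = L ! (k + i)"
        using x \<open>k < length L\<close> by (auto simp: in_set_conv_nth)
      have "x \<le> L ! k"
        using assms(1) i \<open>k < length L\<close> by (cases i) (auto simp: sorted_wrt_iff_nth_less)
      then show ?thesis using k assms(2) by blast
    qed
    then show ?thesis by (simp add: filter_empty_conv)
  qed
  then have "filter P L = filter P (take k L)"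
    by (metis append_Nil2 append_take_drop_id filter_append)
  then have "length (filter P L) \<le> k"
    using length_filter_le[of P "take k L"] by simp
  with assms(3) show False by simp
qed

lemma decreasing_filter_ge_nth:
  fixes L :: "'a::linorder list"
  assumes "sorted_wrt (\<ge>) L" and "k < length L"
  shows "k < length (filter (\<lambda>x. L ! k \<le> x) L)"
proof -
  have "L ! k \<le> x" if "x \<in> set (take (Suc k) L)" for x
    using that assms
    by (auto simp: in_set_conv_nth sorted_wrt_iff_nth_less less_Suc_eq)
  then have "length (filter (\<lambda>x. L ! k \<le> x) (take (Suc k) L)) = Suc k"
    using assms(2) by (subst filter_True) auto
  moreover have "filter (\<lambda>x. L ! k \<le> x) L =
      filter (\<lambda>x. L ! k \<le> x) (take (Suc k) L) @ filter (\<lambda>x. L ! k \<le> x) (drop (Suc k) L)"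
    by (metis append_take_drop_id filter_append)
  ultimately show ?thesis by simp
qed

lemma length_filter_concat_replicate:
  assumes "finite S"
  shows "length (filter P (concat (map (\<lambda>\<mu>. replicate (d \<mu>) (g \<mu>)) (rev (sorted_list_of_set S)))))
       = (\<Sum>\<mu>\<in>{\<mu>\<in>S. P (g \<mu>)}. d \<mu>)"
proof -
  have *: "length (filter P (concat (map (\<lambda>\<mu>. replicate (d \<mu>) (g \<mu>)) xs)))
       = sum_list (map (\<lambda>\<mu>. if P (g \<mu>) then d \<mu> else 0) xs)" for xs
    by (induction xs) auto
  show ?thesis
    using assms by (simp add: * sum_list_distinct_conv_sum_set sum.inter_filter)
qed

lemma sorted_concat_replicate:
  assumes "mono g" and "sorted_wrt (\<ge>) xs"
  shows "sorted_wrt (\<ge>) (concat (map (\<lambda>\<mu>. replicate (d \<mu>) (g \<mu>)) xs))"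
  using assms(2)
proof (induction xs)
  case (Cons x xs)
  have "sorted_wrt (\<ge>) (replicate k a)" for k and a :: 'b
    by (induction k) auto
  with Cons show ?case
    using monoD[OF assms(1)] by (auto simp: sorted_wrt_append)
qed simp

section \<open>Eigenspaces of the Gram matrix\<close>

lemma inner_gram:
  fixes X :: "real ^ 'n ^ 'm"
  shows "u \<bullet> ((transpose X ** X) *v v) = (X *v u) \<bullet> (X *v v)"
proof -
  have "((transpose X ** X) *v v) \<bullet> u = (X *v v) \<bullet> (X *v u)"
    by (simp add: dot_lmul_matrix flip: matrix_vector_mul_assoc)
  then show ?thesis by (simp only: inner_commute)
qed

lemma subspace_eigenspace: "subspace (eigenspace A \<mu>)"
  by (simp add: eigenspace_def subspace_def matrix_vector_right_distrib matrix_vector_mult_scaleR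
      scaleR_add_right)

lemma eigenspace_orthogonal:
  fixes X :: "real ^ 'n ^ 'm"
  assumes "u \<in> eigenspace (transpose X ** X) \<mu>" "v \<in> eigenspace (transpose X ** X) \<nu>" "\<mu> \<noteq> \<nu>"
  shows "u \<bullet> v = 0"
proof -
  have "\<nu> * (u \<bullet> v) = \<mu> * (u \<bullet> v)"
    using assms(1,2) inner_gram[of u X v] inner_gram[of v X u]
    by (auto simp: eigenspace_def inner_commute)
  with assms(3) show ?thesis by simp
qed

text \<open>
  Counting eigenvalues with the dimensions of their eigenspaces is the same as measuring one
  subspace, because distinct eigenspaces are orthogonal.
\<close>

lemma dim_Union_eigenspaces:
  fixes X :: "real ^ 'n ^ 'm"
  assumes "finite T"
  shows "dim (\<Union>\<mu>\<in>T. eigenspace (transpose X ** X) \<mu>) = (\<Sum>\<mu>\<in>T. dim (eigenspace (transpose X ** X) \<mu>))"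
  using assms
proof (induction T)
  case (insert \<mu> T)
  have "dim (eigenspace (transpose X ** X) \<mu> \<union> (\<Union>\<nu>\<in>T. eigenspace (transpose X ** X) \<nu>))
      = dim (eigenspace (transpose X ** X) \<mu>) + dim (\<Union>\<nu>\<in>T. eigenspace (transpose X ** X) \<nu>)"
    using insert.hyps by (intro dim_orthogonal_sum) (auto intro: eigenspace_orthogonal)
  with insert show ?case by simp
qed simp

lemma dim_eigenspace_pos: "\<mu> \<in> eigenvalues A \<Longrightarrow> 0 < dim (eigenspace A \<mu>)"
  by (auto simp: eigenvalues_def eigenspace_def intro!: Nat.gr0I)

lemma eigenvalue_gram_nonneg:
  fixes X :: "real ^ 'n ^ 'm"
  assumes "\<mu> \<in> eigenvalues (transpose X ** X)"
  shows "0 \<le> \<mu>"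
proof -
  obtain v where v: "v \<noteq> 0" "(transpose X ** X) *v v = \<mu> *\<^sub>R v"
    using assms by (auto simp: eigenvalues_def eigenspace_def)
  then have "\<mu> * (v \<bullet> v) \<ge> 0"
    using inner_gram[of v X v] by simp
  with v(1) show ?thesis by (simp add: zero_le_mult_iff not_le flip: inner_gt_zero_iff)
qed

lemma finite_eigenvalues_gram:
  fixes X :: "real ^ 'n ^ 'm"
  shows "finite (eigenvalues (transpose X ** X))"
proof -
  let ?d = "\<lambda>\<mu>. dim (eigenspace (transpose X ** X) \<mu>)"
  have "card T \<le> CARD('n)" if T: "T \<subseteq> eigenvalues (transpose X ** X)" "finite T" for T
  proof -
    have "card T \<le> sum ?d T"
      using sum_mono[of T "\<lambda>_. 1::nat" ?d] dim_eigenspace_pos T(1) by (fastforce simp: Suc_le_eq)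
    also have "\<dots> \<le> CARD('n)"
      unfolding dim_Union_eigenspaces[OF T(2), symmetric] by (rule dim_subset_UNIV_cart)
    finally show ?thesis .
  qed
  then show ?thesis
    using finite_if_finite_subsets_card_bdd by blast
qed

lemma norm_add_scaleR_squared:
  fixes a b :: "'a::real_inner"
  shows "(norm (a + t *\<^sub>R b))\<^sup>2 = (norm a)\<^sup>2 + 2 * t * (b \<bullet> a) + t\<^sup>2 * (norm b)\<^sup>2"
  unfolding power2_norm_eq_inner
  by (simp add: inner_add_left inner_add_right inner_commute[of a b] power2_eq_square algebra_simps)

text \<open>
  On the unit sphere of \<open>U\<close> the quadratic form \<open>(norm (X *v v))\<^sup>2\<close> attains its maximum \<open>\<mu>\<close> at some \<open>u\<close>,
  and a maximizer is an eigenvector: the residual \<open>h\<close> of the eigenvalue equation lies in \<open>U\<close>, and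
  a short move from \<open>u\<close> along \<open>h\<close> would increase the quotient if \<open>h\<close> were not zero.
\<close>

lemma gram_eigenvector_exists:
  fixes X :: "real ^ 'n ^ 'm" and U :: "(real ^ 'n) set"
  assumes U: "subspace U" and inv: "\<And>u. u \<in> U \<Longrightarrow> (transpose X ** X) *v u \<in> U"
    and w: "w \<in> U" "X *v w \<noteq> 0"
  obtains \<mu> u where "0 < \<mu>" "u \<in> U" "u \<noteq> 0" "u \<in> eigenspace (transpose X ** X) \<mu>"
proof -
  let ?K = "U \<inter> sphere 0 1"
  have w0: "w \<noteq> 0" using w(2) by auto
  have "w /\<^sub>R norm w \<in> ?K"
    using w(1) w0 U by (simp add: subspace_scale)
  moreover have "compact ?K"
    using U by (simp add: closed_Int_compact closed_subspace)
  moreover have "continuous_on ?K (\<lambda>u. (norm (X *v u))\<^sup>2)"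
    by (intro continuous_intros linear_continuous_on matrix_vector_mul_bounded_linear)
  ultimately obtain u where u: "u \<in> ?K" "\<And>v. v \<in> ?K \<Longrightarrow> (norm (X *v v))\<^sup>2 \<le> (norm (X *v u))\<^sup>2"
    using continuous_attains_sup[of ?K "\<lambda>u. (norm (X *v u))\<^sup>2"] by (metis empty_iff)
  define \<mu> where "\<mu> = (norm (X *v u))\<^sup>2"
  have bound: "(norm (X *v v))\<^sup>2 \<le> \<mu> * (norm v)\<^sup>2" if "v \<in> U" for v
  proof (cases "v = 0")
    case False
    then have "(norm (X *v (v /\<^sub>R norm v)))\<^sup>2 \<le> \<mu>"
      unfolding \<mu>_def using that U by (intro u(2)) (simp add: subspace_scale)
    with False show ?thesis
      by (simp add: matrix_vector_mult_scaleR power_mult_distrib field_simps)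
  qed simp
  have "\<mu> > 0"
    using bound[OF w(1)] w w0 by (metis \<mu>_def mult_zero_left norm_eq_zero norm_le_zero_iff
        power2_eq_square power_eq_0_iff zero_le_power2 not_le order_antisym_conv zero_less_power2)
  define h where "h = (transpose X ** X) *v u - \<mu> *\<^sub>R u"
  have hU: "h \<in> U"
    unfolding h_def using u(1) U inv by (intro subspace_diff subspace_scale) auto
  have uu: "u \<bullet> u = 1" "norm u = 1" using u(1) by (auto simp: norm_eq_1)
  have "2 * (h \<bullet> h) \<le> t * (\<mu> * (h \<bullet> h))" if "t > 0" for t
  proof -
    have "(norm (X *v (u + t *\<^sub>R h)))\<^sup>2 \<le> \<mu> * (norm (u + t *\<^sub>R h))\<^sup>2"
      using hU u(1) U by (intro bound) (auto intro: subspace_add subspace_scale)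
    moreover have "(norm (X *v (u + t *\<^sub>R h)))\<^sup>2
        = \<mu> + 2 * t * ((X *v h) \<bullet> (X *v u)) + t\<^sup>2 * (norm (X *v h))\<^sup>2"
      by (simp add: \<mu>_def matrix_vector_right_distrib matrix_vector_mult_scaleR norm_add_scaleR_squared)
    moreover have "(norm (u + t *\<^sub>R h))\<^sup>2 = 1 + 2 * t * (h \<bullet> u) + t\<^sup>2 * (h \<bullet> h)"
      using uu by (simp add: norm_add_scaleR_squared dot_square_norm)
    moreover have "(X *v h) \<bullet> (X *v u) = h \<bullet> h + \<mu> * (h \<bullet> u)"
    proof -
      have "(transpose X ** X) *v u = h + \<mu> *\<^sub>R u" by (simp add: h_def)
      then show ?thesis unfolding inner_gram[symmetric] by (simp add: inner_add_right)
    qed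
    ultimately have "t * (2 * (h \<bullet> h)) + t\<^sup>2 * (norm (X *v h))\<^sup>2 \<le> t * (t * (\<mu> * (h \<bullet> h)))"
      by (simp add: algebra_simps power2_eq_square)
    then have "t * (2 * (h \<bullet> h)) \<le> t * (t * (\<mu> * (h \<bullet> h)))"
      by (smt (verit) mult_nonneg_nonneg zero_le_power2)
    with that show ?thesis by (simp only: mult_le_cancel_left_pos)
  qed
  \<comment> \<open>Any \<open>t\<close> below \<open>2 / \<mu>\<close> gives a contradiction unless \<open>h = 0\<close>.\<close>
  from this[of "1 / \<mu>"] \<open>\<mu> > 0\<close> have "h \<bullet> h \<le> 0" by simp
  then have "h = 0" by (metis inner_eq_zero_iff inner_ge_zero order_antisym)
  with \<open>\<mu> > 0\<close> u(1) uu show ?thesis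
    by (intro that[of \<mu> u]) (auto simp: h_def eigenspace_def)
qed

text \<open>
  The orthogonal complement \<open>U\<close> of the
  eigenspaces for positive eigenvalues is invariant and contains no eigenvector of that kind, so
  \<open>X\<close> vanishes on it. The range of \<open>X\<close> is therefore the image of the span of these eigenspaces.
\<close>

lemma rank_le_dim_positive_eigenspaces:
  fixes X :: "real ^ 'n ^ 'm"
  shows "rank X \<le> dim (\<Union>\<mu>\<in>{\<mu> \<in> eigenvalues (transpose X ** X). 0 < \<mu>}. eigenspace (transpose X ** X) \<mu>)"
proof -
  define M where "M = transpose X ** X"
  define W where "W = (\<Union>\<mu>\<in>{\<mu> \<in> eigenvalues M. 0 < \<mu>}. eigenspace M \<mu>)"
  define U where "U = {u. \<forall>w\<in>W. w \<bullet> u = 0}"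
  have sub: "subspace U"
    by (auto simp: U_def subspace_def inner_simps)
  have inv: "M *v u \<in> U" if "u \<in> U" for u
  proof -
    have "w \<bullet> (M *v u) = 0" if w: "w \<in> W" for w
    proof -
      obtain \<mu> where "w \<in> eigenspace M \<mu>" using w unfolding W_def by blast
      then have "u \<bullet> (M *v w) = \<mu> * (w \<bullet> u)" by (simp add: eigenspace_def inner_commute)
      moreover have "w \<bullet> u = 0" using \<open>u \<in> U\<close> w by (auto simp: U_def)
      moreover have "w \<bullet> (M *v u) = u \<bullet> (M *v w)"
        unfolding M_def inner_gram by (rule inner_commute)
      ultimately show ?thesis by simp
    qed
    then show ?thesis by (simp add: U_def)
  qed
  have zero: "X *v u = 0" if "u \<in> U" for u
  proof (rule ccontr)
    assume "X *v u \<noteq> 0"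
    then obtain \<mu> v where v: "0 < \<mu>" "v \<in> U" "v \<noteq> 0" "v \<in> eigenspace M \<mu>"
      using gram_eigenvector_exists[of U X u] sub inv \<open>u \<in> U\<close> unfolding M_def by metis
    then have "v \<in> W" by (auto simp: W_def eigenvalues_def)
    with v(2,3) show False by (auto simp: U_def)
  qed
  have "range ((*v) X) \<subseteq> (*v) X ` span W"
  proof safe
    fix x
    obtain y z where yz: "y \<in> span W" "\<And>w. w \<in> span W \<Longrightarrow> orthogonal z w" "x = y + z"
      by (rule orthogonal_subspace_decomp_exists[of W x]) auto
    then have "z \<in> U"
      by (auto simp: U_def orthogonal_def inner_commute span_base)
    with yz zero show "X *v x \<in> (*v) X ` span W"
      by (auto simp: matrix_vector_right_distrib)
  qed
  then have "rank X \<le> dim ((*v) X ` span W)"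
    unfolding rank_dim_range by (rule dim_subset)
  also have "\<dots> \<le> dim (span W)"
    by (intro dim_image_le matrix_vector_mul_linear)
  finally show ?thesis by (simp add: W_def M_def)
qed

lemma gram_lower_bound_on_eigenspaces:
  fixes X :: "real ^ 'n ^ 'm"
  assumes "finite T" and "\<And>\<mu>. \<mu> \<in> T \<Longrightarrow> s \<le> \<mu>"
    and "v \<in> span (\<Union>\<mu>\<in>T. eigenspace (transpose X ** X) \<mu>)"
  shows "s * (norm v)\<^sup>2 \<le> (norm (X *v v))\<^sup>2"
  using assms
proof (induction T arbitrary: v)
  case (insert \<mu> T)
  let ?S = "\<Union>\<nu>\<in>T. eigenspace (transpose X ** X) \<nu>"
  have "v \<in> span (eigenspace (transpose X ** X) \<mu> \<union> ?S)"
    using insert.prems by simp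
  then obtain a b where a: "a \<in> eigenspace (transpose X ** X) \<mu>" and b: "b \<in> span ?S" and v: "v = a + b"
    unfolding span_Un span_eq_iff[THEN iffD2, OF subspace_eigenspace] by blast
  have "orthogonal a b"
    using b by (rule orthogonal_to_span)
      (use a insert.hyps in \<open>auto simp: orthogonal_def intro: eigenspace_orthogonal\<close>)
  then have ab: "a \<bullet> b = 0" by (simp add: orthogonal_def)
  have X: "(X *v a) \<bullet> (X *v x) = \<mu> * (a \<bullet> x)" for x
    using a inner_gram[of x X a] by (simp add: eigenspace_def inner_commute)
  have "s * (norm b)\<^sup>2 \<le> (norm (X *v b))\<^sup>2"
    using insert b by simp
  moreover have "s * (norm a)\<^sup>2 \<le> (norm (X *v a))\<^sup>2"
    using insert.prems(1)[of \<mu>] by (simp add: power2_norm_eq_inner X mult_right_mono)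
  ultimately show ?case
    using ab X[of b] unfolding v
    by (simp add: power2_norm_eq_inner matrix_vector_right_distrib inner_simps inner_commute algebra_simps)
qed simp

section \<open>Singular values and rank\<close>

text \<open>
  The list of which \<open>singular_values\<close> keeps an initial segment. Without the truncation, its entries
  with a given property are counted by the dimension of a sum of eigenspaces.
\<close>

definition gram_roots :: "real ^ 'n ^ 'm \<Rightarrow> real list" where
  "gram_roots X = concat (map (\<lambda>\<mu>. replicate (dim (eigenspace (transpose X ** X) \<mu>)) (sqrt \<mu>))
     (rev (sorted_list_of_set (eigenvalues (transpose X ** X)))))"

lemma sorted_gram_roots: "sorted_wrt (\<ge>) (gram_roots X)"
  unfolding gram_roots_def
  by (intro sorted_concat_replicate) (auto simp: mono_def sorted_wrt_rev)

lemma length_filter_gram_roots: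
  fixes X :: "real ^ 'n ^ 'm"
  shows "length (filter P (gram_roots X)) =
    dim (\<Union>\<mu>\<in>{\<mu> \<in> eigenvalues (transpose X ** X). P (sqrt \<mu>)}. eigenspace (transpose X ** X) \<mu>)"
  unfolding gram_roots_def
  by (simp add: length_filter_concat_replicate finite_eigenvalues_gram dim_Union_eigenspaces)

lemma sing_val_eq_gram_roots:
  fixes X :: "real ^ 'n ^ 'm"
  assumes "0 < k" "k \<le> rank X"
  shows "sing_val k X = gram_roots X ! (k - 1)"
proof -
  have "k - 1 < min CARD('m) CARD('n)"
    using assms rank_bound[of X] by linarith
  then show ?thesis
    by (simp add: sing_val_def singular_values_def Let_def gram_roots_def del: min_less_iff_conj)
qed

lemma rank_le_positive_gram_roots: "rank X \<le> length (filter (\<lambda>x. 0 < x) (gram_roots X))"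
  using rank_le_dim_positive_eigenspaces[of X] by (simp add: length_filter_gram_roots)

lemma sing_val_pos:
  fixes X :: "real ^ 'n ^ 'm"
  assumes "0 < k" "k \<le> rank X"
  shows "0 < sing_val k X"
  unfolding sing_val_eq_gram_roots[OF assms]
proof (rule decreasing_nth_of_filter[OF sorted_gram_roots])
  show "k - 1 < length (filter (\<lambda>x. 0 < x) (gram_roots X))"
    using assms rank_le_positive_gram_roots[of X] by linarith
qed auto

text \<open>
  \<open>X\<close> is bounded below by its \<open>k\<close>-th singular value \<open>\<sigma>\<close> on the span of the eigenspaces that belong to
  singular values at least \<open>\<sigma>\<close>. This span has dimension at least \<open>k\<close>, so \<open>A\<close> kills a vector in it.
\<close>

lemma sing_val_le_dist_lower_rank:
  fixes A X :: "real ^ 'n ^ 'm"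
  assumes "rank A < k" "k \<le> rank X"
  shows "sing_val k X \<le> norm (X - A)"
proof -
  let ?M = "transpose X ** X"
  have k: "0 < k" using assms by simp
  define \<sigma> where "\<sigma> = sing_val k X"
  have \<sigma>: "\<sigma> > 0" "\<sigma> = gram_roots X ! (k - 1)"
    unfolding \<sigma>_def using sing_val_pos[OF k assms(2)] sing_val_eq_gram_roots[OF k assms(2)] by auto
  have "k \<le> length (gram_roots X)"
    using assms(2) rank_le_positive_gram_roots[of X]
      length_filter_le[of "\<lambda>x. 0 < x" "gram_roots X"] by linarith
  then have "k - 1 < length (filter (\<lambda>x. \<sigma> \<le> x) (gram_roots X))"
    unfolding \<sigma>(2) using k by (intro decreasing_filter_ge_nth sorted_gram_roots) simp
  define T where "T = {\<mu> \<in> eigenvalues ?M. \<sigma> \<le> sqrt \<mu>}"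
  define W where "W = (\<Union>\<mu>\<in>T. eigenspace ?M \<mu>)"
  have "rank A < dim (span W)"
    using \<open>k - 1 < _\<close> assms(1) by (simp add: length_filter_gram_roots W_def T_def)
  then obtain v where v: "v \<in> span W" "v \<noteq> 0" "A *v v = 0"
    using rank_less_imp_kernel_vector[OF subspace_span] by blast
  have "\<sigma>\<^sup>2 * (norm v)\<^sup>2 \<le> (norm (X *v v))\<^sup>2"
  proof (rule gram_lower_bound_on_eigenspaces)
    show "finite T" by (simp add: T_def finite_eigenvalues_gram)
    show "v \<in> span (\<Union>\<mu>\<in>T. eigenspace ?M \<mu>)" using v(1) by (simp add: W_def)
    show "\<sigma>\<^sup>2 \<le> \<mu>" if "\<mu> \<in> T" for \<mu>
      using that \<sigma>(1) eigenvalue_gram_nonneg[of \<mu> X] power_mono[of \<sigma> "sqrt \<mu>" 2]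
      by (simp add: T_def)
  qed
  then have "(\<sigma> * norm v)\<^sup>2 \<le> (norm (X *v v))\<^sup>2"
    by (simp add: power_mult_distrib)
  then have "\<sigma> * norm v \<le> norm (X *v v)"
    by (rule power2_le_imp_le) simp
  also have "\<dots> = norm ((X - A) *v v)"
    using v(3) by (simp add: matrix_vector_mult_diff_rdistrib)
  also have "\<dots> \<le> norm (X - A) * norm v"
    by (rule norm_matrix_vector_mult_le)
  finally show ?thesis using v(2) by (simp add: \<sigma>_def)
qed

section \<open>Tangent cones and projections onto closed cones\<close>

text \<open>
  Spares the diagonal argument with sequences for closedness, which becomes a choice of \<open>e / 2\<close>.
\<close>

lemma tangent_cone_iff:
  fixes S :: "'a::real_normed_vector set"
  shows "Z \<in> tangent_cone S X \<longleftrightarrow>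
    (\<forall>e>0. \<exists>x\<in>S. \<exists>t>0. norm (x - X) < e \<and> norm ((x - X) /\<^sub>R t - Z) < e)"
proof
  assume "Z \<in> tangent_cone S X"
  then obtain x t where xt: "\<And>i. x i \<in> S" "x \<longlonglongrightarrow> X" "\<And>i. t i > (0::real)"
    "(\<lambda>i. (x i - X) /\<^sub>R t i) \<longlonglongrightarrow> Z"
    unfolding tangent_cone_def by blast
  show "\<forall>e>0. \<exists>x\<in>S. \<exists>t>0. norm (x - X) < e \<and> norm ((x - X) /\<^sub>R t - Z) < e"
  proof (intro allI impI)
    fix e :: real assume "e > 0"
    then have "\<forall>\<^sub>F i in sequentially. norm (x i - X) < e \<and> norm ((x i - X) /\<^sub>R t i - Z) < e"
      using tendstoD[OF xt(2), of e] tendstoD[OF xt(4), of e] by (simp add: dist_norm eventually_conj)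
    then obtain i where "norm (x i - X) < e \<and> norm ((x i - X) /\<^sub>R t i - Z) < e"
      using eventually_happens'[OF sequentially_bot] by blast
    then show "\<exists>x\<in>S. \<exists>t>0. norm (x - X) < e \<and> norm ((x - X) /\<^sub>R t - Z) < e"
      using xt(1,3) by blast
  qed
next
  assume R: "\<forall>e>0. \<exists>x\<in>S. \<exists>t>0. norm (x - X) < e \<and> norm ((x - X) /\<^sub>R t - Z) < e"
  have "\<exists>p. fst p \<in> S \<and> snd p > 0 \<and> norm (fst p - X) < inverse (real (Suc i)) \<and>
      norm ((fst p - X) /\<^sub>R snd p - Z) < inverse (real (Suc i))" for i
  proof -
    have "inverse (real (Suc i)) > 0" by simp
    with R obtain x t where "x \<in> S" "t > 0" "norm (x - X) < inverse (real (Suc i))"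
      "norm ((x - X) /\<^sub>R t - Z) < inverse (real (Suc i))" by meson
    then show ?thesis by (intro exI[of _ "(x, t)"]) simp
  qed
  then obtain p where p: "\<And>i. fst (p i) \<in> S \<and> snd (p i) > 0 \<and>
      norm (fst (p i) - X) < inverse (real (Suc i)) \<and>
      norm ((fst (p i) - X) /\<^sub>R snd (p i) - Z) < inverse (real (Suc i))"
    by metis
  have "(\<lambda>i. fst (p i)) \<longlonglongrightarrow> X"
    by (rule LIM_zero_cancel, rule tendsto_norm_zero_cancel,
        rule tendsto_sandwich[OF _ _ tendsto_const LIMSEQ_inverse_real_of_nat])
      (use p less_imp_le in \<open>auto intro!: always_eventually\<close>)
  moreover have "(\<lambda>i. (fst (p i) - X) /\<^sub>R snd (p i)) \<longlonglongrightarrow> Z"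
    by (rule LIM_zero_cancel, rule tendsto_norm_zero_cancel,
        rule tendsto_sandwich[OF _ _ tendsto_const LIMSEQ_inverse_real_of_nat])
      (use p less_imp_le in \<open>auto intro!: always_eventually\<close>)
  ultimately show "Z \<in> tangent_cone S X"
    unfolding tangent_cone_def using p by (intro CollectI exI[of _ "\<lambda>i. fst (p i)"] exI[of _ "\<lambda>i. snd (p i)"]) auto
qed

lemma closed_tangent_cone: "closed (tangent_cone S X)"
proof -
  have "Z \<in> tangent_cone S X" if Z: "Z \<in> closure (tangent_cone S X)" for Z
    unfolding tangent_cone_iff
  proof (intro allI impI)
    fix e :: real assume e: "e > 0"
    then obtain W where W: "W \<in> tangent_cone S X" "dist W Z < e / 2"
      using Z unfolding closure_approachable by (meson half_gt_zero)
    then obtain x t where "x \<in> S" "t > 0" "norm (x - X) < e / 2" "norm ((x - X) /\<^sub>R t - W) < e / 2"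
      using e unfolding tangent_cone_iff by (meson half_gt_zero)
    then show "\<exists>x\<in>S. \<exists>t>0. norm (x - X) < e \<and> norm ((x - X) /\<^sub>R t - Z) < e"
      using W(2) e norm_triangle_lt[of "(x - X) /\<^sub>R t - W" "W - Z" e]
      by (intro bexI[of _ x] exI[of _ t]) (auto simp: dist_norm)
  qed
  then show ?thesis
    by (metis closure_subset closed_closure subsetI subset_antisym)
qed

lemma tangent_cone_scaleR:
  assumes "Z \<in> tangent_cone S X" "0 < a"
  shows "a *\<^sub>R Z \<in> tangent_cone S X"
proof -
  obtain x t where xt: "\<And>i. x i \<in> S" "x \<longlonglongrightarrow> X" "\<And>i. t i > (0::real)"
    "(\<lambda>i. (x i - X) /\<^sub>R t i) \<longlonglongrightarrow> Z"
    using assms(1) unfolding tangent_cone_def by blast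
  have "(\<lambda>i. (x i - X) /\<^sub>R (t i / a)) \<longlonglongrightarrow> a *\<^sub>R Z"
    using tendsto_scaleR[OF tendsto_const[of a] xt(4)] assms(2) by (simp add: field_simps)
  with xt assms(2) show ?thesis
    unfolding tangent_cone_def by (intro CollectI exI[of _ x] exI[of _ "\<lambda>i. t i / a"]) auto
qed

lemma zero_in_tangent_cone: "X \<in> S \<Longrightarrow> 0 \<in> tangent_cone S X"
  unfolding tangent_cone_iff by (force intro: exI[of _ 1])

lemma proj_closed_cone_exists:
  fixes K :: "'a::euclidean_space set"
  assumes "closed K" "K \<noteq> {}"
  shows "proj_set K g \<noteq> {}"
proof -
  obtain P where "P \<in> K" "\<And>Z. Z \<in> K \<Longrightarrow> dist g P \<le> dist g Z"
    using distance_attains_inf[OF assms] by blast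
  then have "P \<in> proj_set K g"
    by (auto simp: proj_set_def argmin_set_def is_arg_min_def dist_norm not_less)
  then show ?thesis by blast
qed

text \<open>
  A projection \<open>P\<close> of \<open>g\<close> onto a cone is a best approximation along each ray of the cone. Comparing it
  with the best point of the ray through \<open>Z\<close> gives the inequality \<open>key\<close> below; for \<open>Z = P\<close> it forces
  \<open>g \<bullet> P = (norm P)\<^sup>2\<close>, and then for general \<open>Z\<close> it says that the norm of \<open>P\<close> bounds the
  component of \<open>g\<close> in each direction of the cone.
\<close>

lemma inner_le_norm_proj_cone:
  fixes K :: "'a::real_inner set"
  assumes zero: "0 \<in> K" and scale: "\<And>Z a. Z \<in> K \<Longrightarrow> 0 < a \<Longrightarrow> a *\<^sub>R Z \<in> K"
    and P: "P \<in> proj_set K g"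
  shows "g \<bullet> P = (norm P)\<^sup>2" and "Z \<in> K \<Longrightarrow> g \<bullet> Z \<le> norm P * norm Z"
proof -
  have PK: "P \<in> K" and Pmin: "\<And>Z. Z \<in> K \<Longrightarrow> (norm (g - P))\<^sup>2 \<le> (norm (g - Z))\<^sup>2"
    using P by (auto simp: proj_set_def argmin_set_def is_arg_min_def not_less intro!: power_mono)
  have norm_diff: "(norm (g - Z))\<^sup>2 = (norm g)\<^sup>2 - 2 * (g \<bullet> Z) + (norm Z)\<^sup>2" for Z
    unfolding power2_norm_eq_inner by (simp add: inner_diff_left inner_diff_right inner_commute[of g Z])
  define a p where "a = g \<bullet> P" and "p = (norm P)\<^sup>2"
  have key: "(g \<bullet> Z)\<^sup>2 \<le> (2 * a - p) * (norm Z)\<^sup>2" if Z: "Z \<in> K" "0 < g \<bullet> Z" for Z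
  proof -
    define z where "z = (norm Z)\<^sup>2"
    have z: "z > 0" using Z(2) by (auto simp: z_def)
    define b where "b = (g \<bullet> Z) / z"
    have "b *\<^sub>R Z \<in> K" using Z z by (intro scale) (auto simp: b_def)
    from Pmin[OF this] have "p - 2 * a \<le> b\<^sup>2 * z - 2 * (b * (g \<bullet> Z))"
      unfolding norm_diff by (simp add: a_def p_def z_def power_mult_distrib)
    also have "\<dots> = - ((g \<bullet> Z)\<^sup>2 / z)"
      using z by (simp add: b_def field_simps power2_eq_square)
    finally have "(g \<bullet> Z)\<^sup>2 / z \<le> 2 * a - p" by simp
    then show ?thesis using z unfolding z_def[symmetric] by (simp add: field_simps)
  qed
  have "p \<le> 2 * a"
    using Pmin[OF zero] unfolding norm_diff by (simp add: a_def p_def)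
  have "a = p"
  proof (cases "P = 0")
    case False
    then have "p > 0" by (simp add: p_def)
    with \<open>p \<le> 2 * a\<close> have "0 < a" by linarith
    with key[OF PK] have "a\<^sup>2 \<le> (2 * a - p) * p"
      by (simp add: a_def p_def)
    then have "(a - p)\<^sup>2 \<le> 0" by (simp add: power2_eq_square algebra_simps)
    then show ?thesis by simp
  qed (simp add: a_def p_def)
  then show "g \<bullet> P = (norm P)\<^sup>2" by (simp add: a_def p_def)
  show "g \<bullet> Z \<le> norm P * norm Z" if "Z \<in> K"
  proof (cases "0 < g \<bullet> Z")
    case True
    from key[OF that this] \<open>a = p\<close> have "(g \<bullet> Z)\<^sup>2 \<le> (norm P * norm Z)\<^sup>2"
      by (simp add: p_def power_mult_distrib)
    then show ?thesis by (rule power2_le_imp_le) simp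
  next
    case False
    then show ?thesis by (meson mult_nonneg_nonneg norm_ge_zero not_less order_trans)
  qed
qed

section \<open>The stationarity measure\<close>

text \<open>
  The two properties of the stationarity measure on which everything else rests: it dominates
  the slope of \<open>-f\<close> in each tangent direction, so it vanishes only at B-stationary points.
  By the cone inequality, each of two projections has at most the norm of the other one, so the
  set of norms in the definition is indeed a singleton.
\<close>

lemma
  fixes X :: "real ^ 'n ^ 'm"
  assumes "X \<in> rank_le r"
  shows stat_measure_nonneg: "0 \<le> stat_measure f r X"
    and inner_le_stat_measure:
      "Z \<in> tangent_cone (rank_le r) X \<Longrightarrow> (- grad f X) \<bullet> Z \<le> stat_measure f r X * norm Z"
proof -
  let ?K = "tangent_cone (rank_le r) X" and ?g = "- grad f X"
  have K: "0 \<in> ?K" "\<And>Z a. Z \<in> ?K \<Longrightarrow> 0 < a \<Longrightarrow> a *\<^sub>R Z \<in> ?K"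
    by (simp_all add: zero_in_tangent_cone assms tangent_cone_scaleR)
  obtain P where P: "P \<in> proj_set ?K ?g"
    using proj_closed_cone_exists[OF closed_tangent_cone] K(1) by (metis empty_iff ex_in_conv)
  have le: "norm Q \<le> norm R" if "Q \<in> proj_set ?K ?g" "R \<in> proj_set ?K ?g" for Q R
  proof -
    have "Q \<in> ?K" using that(1) by (simp add: proj_set_def argmin_set_def is_arg_min_def)
    then have "norm Q * norm Q \<le> norm R * norm Q"
      using inner_le_norm_proj_cone(1)[OF K that(1)] inner_le_norm_proj_cone(2)[OF K that(2), of Q]
      by (simp add: power2_eq_square)
    then show ?thesis by (metis mult_right_le_imp_le norm_ge_zero order_le_less)
  qed
  have "norm ` proj_set ?K ?g = {norm P}"
    using le P by (auto intro: antisym)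
  then have s: "stat_measure f r X = norm P" by (simp add: stat_measure_def)
  show "0 \<le> stat_measure f r X" by (simp add: s)
  show "?g \<bullet> Z \<le> stat_measure f r X * norm Z" if "Z \<in> ?K"
    unfolding s by (rule inner_le_norm_proj_cone(2)[OF K P that])
qed

lemma B_stationary_if_stat_measure_zero:
  assumes "X \<in> rank_le r" "\<not> 0 < stat_measure f r X"
  shows "B_stationary f r X"
  using inner_le_stat_measure[OF assms(1), of _ f] stat_measure_nonneg[OF assms(1), of f] assms
  by (force simp: B_stationary_def)

section \<open>Tangent vectors to the set of matrices of bounded rank\<close>

text \<open>
  The curve \<open>(mat 1 + t *\<^sub>R C) ** X ** (mat 1 + t *\<^sub>R B)\<close> does not increase the rank and has this
  initial velocity.
\<close>

lemma two_sided_in_tangent_cone: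
  fixes X :: "real ^ 'n ^ 'm"
  assumes "X \<in> rank_le r"
  shows "C ** X + X ** B \<in> tangent_cone (rank_le r) X"
proof -
  define x where "x t = X + t *\<^sub>R (C ** X + X ** B) + (t * t) *\<^sub>R (C ** X ** B)" for t
  have factor: "x t = (mat 1 + t *\<^sub>R C) ** (X ** (mat 1 + t *\<^sub>R B))" for t
    by (simp add: x_def matrix_eq matrix_vector_mult_add_rdistrib matrix_vector_right_distrib
        matrix_vector_mult_scaleR scaleR_add_right
        flip: matrix_vector_mul_assoc scaleR_matrix_vector_assoc)
  have "x t \<in> rank_le r" for t
  proof -
    have "rank (x t) \<le> rank X"
      unfolding factor by (meson rank_mul_le_left rank_mul_le_right order_trans)
    with assms show ?thesis by (simp add: rank_le_def)
  qed
  moreover have "(\<lambda>i. x (inverse (real (Suc i)))) \<longlonglongrightarrow> X"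
    unfolding x_def by (rule tendsto_eq_intros LIMSEQ_inverse_real_of_nat refl)+ simp
  moreover have "(\<lambda>i. (x (inverse (real (Suc i))) - X) /\<^sub>R inverse (real (Suc i))) \<longlonglongrightarrow> C ** X + X ** B"
  proof -
    have "(x t - X) /\<^sub>R t = C ** X + X ** B + t *\<^sub>R (C ** X ** B)" if "t \<noteq> 0" for t
      using that by (simp add: x_def scaleR_add_right)
    then have "(\<lambda>i. (x (inverse (real (Suc i))) - X) /\<^sub>R inverse (real (Suc i))) =
        (\<lambda>i. C ** X + X ** B + inverse (real (Suc i)) *\<^sub>R (C ** X ** B))"
      by (intro ext) (simp only: inverse_nonzero_iff_nonzero of_nat_eq_0_iff nat.simps not_False_eq_True)
    moreover have "(\<lambda>i. C ** X + X ** B + inverse (real (Suc i)) *\<^sub>R (C ** X ** B)) \<longlonglongrightarrow> C ** X + X ** B"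
      by (rule tendsto_eq_intros LIMSEQ_inverse_real_of_nat refl)+ simp
    ultimately show ?thesis by (simp only:)
  qed
  ultimately show ?thesis
    unfolding tangent_cone_def
    by (intro CollectI exI[of _ "\<lambda>i. x (inverse (real (Suc i)))"] exI[of _ "\<lambda>i. inverse (real (Suc i))"]) auto
qed

lemma outer_scaleR_left: "outer (a *\<^sub>R w) v = a *\<^sub>R outer w v"
  by (simp add: outer_def vec_eq_iff)

lemma outer_in_tangent_cone:
  fixes X :: "real ^ 'n ^ 'm"
  assumes "rank X < r"
  shows "outer w v \<in> tangent_cone (rank_le r) X"
proof -
  let ?t = "\<lambda>i. inverse (real (Suc i))"
  have "X + ?t i *\<^sub>R outer w v \<in> rank_le r" for i
    using rank_add_outer_le[of X "?t i *\<^sub>R w" v] assms by (simp add: rank_le_def outer_scaleR_left)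
  moreover have "(\<lambda>i. X + ?t i *\<^sub>R outer w v) \<longlonglongrightarrow> X"
    by (rule tendsto_eq_intros LIMSEQ_inverse_real_of_nat refl)+ simp
  ultimately show ?thesis
    unfolding tangent_cone_def
    by (intro CollectI exI[of _ "\<lambda>i. X + ?t i *\<^sub>R outer w v"] exI[of _ ?t]) auto
qed

lemma matrix_mult_outer: "Y ** outer w v = outer (Y *v w) v"
  by (simp add: matrix_eq outer_mult_vec matrix_vector_mult_scaleR flip: matrix_vector_mul_assoc)

lemma bounded_linear_outer_left: "bounded_linear (\<lambda>w. outer w v)"
  by (rule bounded_linear_intro[of _ "norm v"])
    (auto simp: outer_def vec_eq_iff norm_outer[unfolded outer_def] scaleR_add_left)

lemma bounded_linear_matrix_vector_left: "bounded_linear (\<lambda>A :: real ^ 'n ^ 'm. A *v x)"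
  by (rule bounded_linear_intro[of _ "norm x"])
    (auto simp: matrix_vector_mult_add_rdistrib scaleR_matrix_vector_assoc norm_matrix_vector_mult_le)

text \<open>
  Let \<open>(Y i - A) / t i\<close> tend to \<open>Z\<close>. As \<open>A *v v = 0\<close>, multiplying \<open>Y i\<close> on the right by
  \<open>mat 1 + (1 / t i) v v\<^sup>T\<close> blows up its action on \<open>v\<close> to the size of \<open>Z *v v\<close> and changes nothing on the
  complement of \<open>v\<close>. The rank stays at most \<open>r\<close>, and the limit \<open>A + (Z v) v\<^sup>T\<close> has in its range both
  \<open>Z *v v\<close> and the range of \<open>A\<close>. The latter already has dimension \<open>r\<close>.
\<close>

lemma tangent_maps_kernel_to_range:
  fixes A Z :: "real ^ 'n ^ 'm"
  assumes "rank A = r" and Z: "Z \<in> tangent_cone (rank_le r) A" and v: "A *v v = 0"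
  shows "Z *v v \<in> range ((*v) A)"
proof (cases "v = 0")
  case True
  then show ?thesis by (metis matrix_vector_mult_0_right rangeI)
next
  case False
  obtain Y t where Yt: "\<And>i. Y i \<in> rank_le r" "Y \<longlonglongrightarrow> A" "\<And>i. t i > (0::real)"
    "(\<lambda>i. (Y i - A) /\<^sub>R t i) \<longlonglongrightarrow> Z"
    using Z unfolding tangent_cone_def by blast
  let ?M = "\<lambda>i. Y i + outer (((Y i - A) /\<^sub>R t i) *v v) v"
  have "?M i = Y i ** (mat 1 + outer (v /\<^sub>R t i) v)" for i
    by (simp add: matrix_add_ldistrib matrix_mult_outer matrix_vector_mult_scaleR v
        matrix_vector_mult_diff_rdistrib flip: scaleR_matrix_vector_assoc)
  then have "?M i \<in> rank_le r" for i
    using rank_mul_le_left[of "Y i" "mat 1 + outer (v /\<^sub>R t i) v"] Yt(1)[of i]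
    by (simp add: rank_le_def)
  moreover have "?M \<longlonglongrightarrow> A + outer (Z *v v) v"
    by (intro tendsto_add Yt bounded_linear.tendsto[OF bounded_linear_outer_left]
        bounded_linear.tendsto[OF bounded_linear_matrix_vector_left])
  ultimately have "A + outer (Z *v v) v \<in> rank_le r"
    by (intro Lim_in_closed_set[OF closed_rank_le _ sequentially_bot]) (auto intro: always_eventually)
  then have "rank (A + outer (Z *v v) v) \<le> rank A"
    using assms(1) by (simp add: rank_le_def)
  moreover have "insert (Z *v v) (range ((*v) A)) \<subseteq> range ((*v) (A + outer (Z *v v) v))"
  proof -
    let ?B = "A + outer (Z *v v) v"
    have vv: "v \<bullet> v \<noteq> 0" using False by simp
    have Bx: "?B *v x = A *v x + (v \<bullet> x) *\<^sub>R (Z *v v)" for x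
      by (simp add: matrix_vector_mult_add_rdistrib outer_mult_vec)
    have "Z *v v = ?B *v (v /\<^sub>R (v \<bullet> v))"
      using vv by (simp add: Bx matrix_vector_mult_scaleR v)
    moreover have "A *v x = ?B *v (x - ((v \<bullet> x) / (v \<bullet> v)) *\<^sub>R v)" for x
      using vv by (simp add: Bx matrix_vector_mult_diff_distrib matrix_vector_mult_scaleR v inner_diff_right)
    ultimately show ?thesis by blast
  qed
  ultimately have "dim (insert (Z *v v) (range ((*v) A))) \<le> dim (range ((*v) A))"
    unfolding rank_dim_range by (meson dim_subset order_trans)
  then have "Z *v v \<in> span (range ((*v) A))"
    by (simp add: dim_insert split: if_splits)
  then show ?thesis
    using span_eq_iff[THEN iffD2, OF subspace_UNIV[THEN linear_subspace_image[OF matrix_vector_mul_linear[of A]]]]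
    by simp
qed

section \<open>Locally Lipschitz gradients\<close>

lemma gderiv_grad:
  fixes f :: "'a::euclidean_space \<Rightarrow> real"
  assumes "f differentiable (at x)"
  shows "GDERIV f x :> grad f x"
proof -
  obtain f' where f': "(f has_derivative f') (at x)"
    using assms by (auto simp: differentiable_def)
  have "f' = (\<lambda>h. h \<bullet> adjoint f' 1)"
    using adjoint_works[OF has_derivative_linear[OF f'], of _ 1] by (simp add: fun_eq_iff)
  then have "GDERIV f x :> adjoint f' 1"
    using f' by (metis gderiv_def)
  moreover have "D = D'" if "GDERIV f x :> D" "GDERIV f x :> D'" for D D'
    using has_derivative_unique[OF that[unfolded gderiv_def]]
    by (metis vector_eq_rdot inner_commute)
  ultimately show ?thesis
    unfolding grad_def by (metis theI)
qed

lemma lipschitz_gradient_on_cball: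
  assumes "locally_lipschitz_gradient f"
  obtains L where "L > 0"
    "\<And>X Y. X \<in> cball A \<rho> \<Longrightarrow> Y \<in> cball A \<rho> \<Longrightarrow> norm (grad f X - grad f Y) \<le> L * norm (X - Y)"
proof -
  obtain M where M: "\<And>X Y. X \<in> cball A \<rho> \<Longrightarrow> Y \<in> cball A \<rho> \<Longrightarrow> X \<noteq> Y \<Longrightarrow>
      norm (grad f X - grad f Y) / norm (X - Y) \<le> M"
    using assms unfolding locally_lipschitz_gradient_def bdd_above_def by blast
  have "norm (grad f X - grad f Y) \<le> max M 1 * norm (X - Y)" if "X \<in> cball A \<rho>" "Y \<in> cball A \<rho>" for X Y
  proof (cases "X = Y")
    case False
    then have "norm (grad f X - grad f Y) \<le> M * norm (X - Y)"
      using M[OF that False] by (simp add: divide_le_eq)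
    also have "\<dots> \<le> max M 1 * norm (X - Y)" by (intro mult_right_mono) auto
    finally show ?thesis .
  qed simp
  then show ?thesis by (intro that[of "max M 1"]) auto
qed

lemma continuous_grad:
  assumes "locally_lipschitz_gradient f"
  shows "(grad f \<longlongrightarrow> grad f A) (nhds A)"
proof -
  obtain L where L: "L > 0"
    "\<And>X Y. X \<in> cball A 1 \<Longrightarrow> Y \<in> cball A 1 \<Longrightarrow> norm (grad f X - grad f Y) \<le> L * norm (X - Y)"
    using lipschitz_gradient_on_cball[OF assms] by blast
  have "((\<lambda>X. L * norm (X - A)) \<longlongrightarrow> L * norm (A - A)) (nhds A)"
    by (intro tendsto_intros filterlim_ident)
  then have lim: "((\<lambda>X. L * norm (X - A)) \<longlongrightarrow> 0) (nhds A)" by simp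
  have "\<forall>\<^sub>F X in nhds A. norm (grad f X - grad f A) \<le> L * norm (X - A)"
    unfolding eventually_nhds_metric
    by (intro exI[of _ 1]) (auto intro!: L(2) simp: dist_commute)
  then have "((\<lambda>X. grad f X - grad f A) \<longlongrightarrow> 0) (nhds A)"
    by (rule Lim_null_comparison[OF _ lim])
  then show ?thesis by (rule LIM_zero_cancel)
qed

lemma gradient_mean_value:
  fixes f :: "'a::euclidean_space \<Rightarrow> real"
  assumes "f differentiable_on UNIV" "0 < a"
  obtains z where "0 < z" "z < a" "f (X + a *\<^sub>R G) - f X = a * (grad f (X + z *\<^sub>R G) \<bullet> G)"
proof -
  have "((\<lambda>a. f (X + a *\<^sub>R G)) has_field_derivative (grad f (X + x *\<^sub>R G) \<bullet> G)) (at x)" for x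
  proof -
    have "(f has_derivative (\<lambda>h. h \<bullet> grad f (X + x *\<^sub>R G))) (at (X + x *\<^sub>R G))"
      using gderiv_grad[of f "X + x *\<^sub>R G"] assms(1)
      by (simp add: differentiable_on_def gderiv_def)
    moreover have "((\<lambda>a. X + a *\<^sub>R G) has_derivative (\<lambda>h. h *\<^sub>R G)) (at x)"
      by (auto intro!: derivative_eq_intros)
    ultimately have "((\<lambda>a. f (X + a *\<^sub>R G)) has_derivative (\<lambda>h. (h *\<^sub>R G) \<bullet> grad f (X + x *\<^sub>R G))) (at x)"
      by (rule has_derivative_compose[rotated])
    then show ?thesis
      by (simp add: has_field_derivative_def inner_commute mult.commute[of _ "_ \<bullet> _"])
  qed
  then obtain z where "0 < z" "z < a"
    "f (X + a *\<^sub>R G) - f (X + 0 *\<^sub>R G) = (a - 0) * (grad f (X + z *\<^sub>R G) \<bullet> G)"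
    using MVT2[OF assms(2), of "\<lambda>a. f (X + a *\<^sub>R G)" "\<lambda>x. grad f (X + x *\<^sub>R G) \<bullet> G"] by blast
  then show ?thesis by (intro that[of z]) auto
qed

section \<open>Decrease of the objective under the ERFD map\<close>

text \<open>
  The second condition on the search direction \<open>G\<close> bounds its length by a multiple of the gradient's, so all
  trial points that start near a given point stay in one ball.
\<close>

lemma norm_le_if_inner_ge_norm_squared:
  fixes G g :: "'a::real_inner"
  assumes "\<kappa> > 0" "\<kappa> * (norm G)\<^sup>2 \<le> G \<bullet> (- g)"
  shows "norm G \<le> norm g / \<kappa>"
proof (cases "G = 0")
  case False
  have "(\<kappa> * norm G) * norm G \<le> norm g * norm G"
    using assms(2) norm_cauchy_schwarz[of G "- g"] by (simp add: power2_eq_square mult_ac)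
  with False have "\<kappa> * norm G \<le> norm g" by simp
  with assms(1) show ?thesis by (simp add: pos_le_divide_eq mult.commute)
qed (use assms in simp)

text \<open>
  On a ball that contains all trial points the gradient has a Lipschitz constant \<open>L\<close>. By the mean
  value theorem the Armijo condition then holds for all step sizes up to \<open>\<tau> = (1 - c) * \<kappa>2 / L\<close>, because
  \<open>L * \<tau> * (norm G)\<^sup>2\<close> is at most the fraction \<open>1 - c\<close> of the slope. Backtracking only shrinks step sizes
  above \<open>\<tau>\<close>, so the accepted one is at least \<open>\<alpha>min\<close>, uniformly near \<open>A\<close>. The first condition on \<open>G\<close>
  turns the decrease into a multiple of the squared stationarity measure.
\<close>

lemma ERFD_sufficient_decrease:
  fixes f :: "real ^ 'n ^ 'm \<Rightarrow> real" and A :: "real ^ 'n ^ 'm"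
  assumes f: "f differentiable_on UNIV" "locally_lipschitz_gradient f"
    and par: "0 < \<alpha>lo" "\<alpha>lo \<le> \<alpha>hi" "\<beta> \<in> {0<..<1}" "c \<in> {0<..<1}" "0 < \<kappa>1" "0 < \<kappa>2"
  obtains \<eta> where "\<eta> > 0"
    "\<And>X Y. X \<in> cball A 1 \<Longrightarrow> Y \<in> ERFD f r \<alpha>lo \<alpha>hi \<beta> c \<kappa>1 \<kappa>2 X \<Longrightarrow>
       f Y \<le> f X - \<eta> * (stat_measure f r X)\<^sup>2"
proof -
  have \<beta>: "0 < \<beta>" "\<beta> < 1" and c: "0 < c" "c < 1" using par by auto
  obtain L1 where L1: "L1 > 0"
    "\<And>X Y. X \<in> cball A 1 \<Longrightarrow> Y \<in> cball A 1 \<Longrightarrow> norm (grad f X - grad f Y) \<le> L1 * norm (X - Y)"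
    using lipschitz_gradient_on_cball[OF f(2)] by blast
  define M where "M = norm (grad f A) + L1"
  have M: "norm (grad f X) \<le> M" if "X \<in> cball A 1" for X
  proof -
    have "norm (grad f X - grad f A) \<le> L1 * 1"
      using L1 that by (intro order_trans[OF L1(2)] mult_left_mono) (auto simp: dist_norm norm_minus_commute)
    then show ?thesis
      using norm_triangle_sub[of "grad f X" "grad f A"] by (simp add: M_def)
  qed
  define R where "R = 1 + \<alpha>hi * (M / \<kappa>2)"
  obtain L where L: "L > 0"
    "\<And>X Y. X \<in> cball A R \<Longrightarrow> Y \<in> cball A R \<Longrightarrow> norm (grad f X - grad f Y) \<le> L * norm (X - Y)"
    using lipschitz_gradient_on_cball[OF f(2)] by blast
  define \<tau> where "\<tau> = (1 - c) * \<kappa>2 / L"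
  define \<alpha>min where "\<alpha>min = min \<alpha>lo (\<beta> * \<tau>)"
  have pos: "\<tau> > 0" "\<alpha>min > 0"
    using par L c \<beta> by (auto simp: \<tau>_def \<alpha>min_def)
  have "f Y \<le> f X - (c * \<alpha>min * \<kappa>1) * (stat_measure f r X)\<^sup>2"
    if X: "X \<in> cball A 1" and Y: "Y \<in> ERFD f r \<alpha>lo \<alpha>hi \<beta> c \<kappa>1 \<kappa>2 X" for X Y
  proof -
    obtain \<alpha> \<alpha>\<^sub>0 G where Y_eq: "Y = X + \<alpha> *\<^sub>R G"
      and G: "max (\<kappa>1 * (stat_measure f r X)\<^sup>2) (\<kappa>2 * (norm G)\<^sup>2) \<le> G \<bullet> (- grad f X)"
      and \<alpha>\<^sub>0: "\<alpha>\<^sub>0 \<in> {\<alpha>lo..\<alpha>hi}"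
      and loop: "while_option (\<lambda>a. f (X + a *\<^sub>R G) > f X + c * a * (grad f X \<bullet> G)) (\<lambda>a. a * \<beta>) \<alpha>\<^sub>0 = Some \<alpha>"
      using Y unfolding ERFD_def by blast
    define q where "q = G \<bullet> (- grad f X)"
    have q: "grad f X \<bullet> G = - q" "\<kappa>1 * (stat_measure f r X)\<^sup>2 \<le> q" "\<kappa>2 * (norm G)\<^sup>2 \<le> q"
      using G by (simp_all add: q_def inner_commute)
    have "0 \<le> q" using q(2) par(5) by (meson less_imp_le mult_nonneg_nonneg order_trans zero_le_power2)
    have normG: "norm G \<le> M / \<kappa>2"
      using norm_le_if_inner_ge_norm_squared[OF par(6) q(3)[unfolded q_def]] M[OF X] par(6)
      by (meson divide_right_mono less_imp_le order_trans)
    have armijo: "f (X + a *\<^sub>R G) \<le> f X + c * a * (grad f X \<bullet> G)" if a: "0 < a" "a \<le> \<alpha>hi" "a \<le> \<tau>" for a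
    proof -
      obtain z where z: "0 < z" "z < a" "f (X + a *\<^sub>R G) - f X = a * (grad f (X + z *\<^sub>R G) \<bullet> G)"
        using gradient_mean_value[OF f(1) a(1)] by blast
      have "z * norm G \<le> \<alpha>hi * (M / \<kappa>2)"
        using z a normG by (intro mult_mono) auto
      moreover have "0 \<le> z * norm G" using z(1) by simp
      moreover have "dist (X + z *\<^sub>R G) A \<le> dist X A + z * norm G"
        using dist_triangle[of "X + z *\<^sub>R G" A X] z(1) by (simp add: dist_norm)
      moreover have "dist X A \<le> 1" using X by (simp add: dist_commute)
      ultimately have "dist (X + z *\<^sub>R G) A \<le> R" "dist X A \<le> R"
        unfolding R_def by linarith+
      then have "X + z *\<^sub>R G \<in> cball A R" "X \<in> cball A R"
        by (simp_all add: dist_commute)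
      then have "norm (grad f (X + z *\<^sub>R G) - grad f X) \<le> L * (z * norm G)"
        using L(2)[of "X + z *\<^sub>R G" X] z(1) by simp
      also have "\<dots> \<le> L * (\<tau> * norm G)"
        using z a L(1) by (intro mult_left_mono mult_right_mono) auto
      finally have "(grad f (X + z *\<^sub>R G) - grad f X) \<bullet> G \<le> L * (\<tau> * norm G) * norm G"
        by (meson mult_right_mono norm_cauchy_schwarz norm_ge_zero order_trans)
      also have "\<dots> = (1 - c) * (\<kappa>2 * (norm G)\<^sup>2)"
        using L(1) by (simp add: \<tau>_def power2_eq_square)
      also have "\<dots> \<le> (1 - c) * q"
        using q(3) c by (intro mult_left_mono) auto
      finally have "grad f (X + z *\<^sub>R G) \<bullet> G \<le> - c * q"
        using q(1) by (simp add: inner_diff_left algebra_simps)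
      then have "a * (grad f (X + z *\<^sub>R G) \<bullet> G) \<le> a * (- c * q)"
        using a(1) by (intro mult_left_mono) auto
      with z(3) q(1) show ?thesis by (simp add: algebra_simps)
    qed
    have "\<alpha>min \<le> \<alpha> \<and> \<alpha> \<le> \<alpha>hi"
    proof (rule while_option_rule[OF _ loop, where P = "\<lambda>a. \<alpha>min \<le> a \<and> a \<le> \<alpha>hi"])
      show "\<alpha>min \<le> \<alpha>\<^sub>0 \<and> \<alpha>\<^sub>0 \<le> \<alpha>hi" using \<alpha>\<^sub>0 by (auto simp: \<alpha>min_def)
      fix a assume a: "\<alpha>min \<le> a \<and> a \<le> \<alpha>hi" "f X + c * a * (grad f X \<bullet> G) < f (X + a *\<^sub>R G)"
      then have "0 < a" using pos by linarith
      with a armijo[of a] have "\<tau> < a" by force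
      \<comment> \<open>The loop goes on only while the Armijo condition fails, that is, only above \<open>\<tau>\<close>.\<close>
      then have "\<beta> * \<tau> \<le> a * \<beta>" using \<beta> by (simp add: mult.commute)
      moreover have "a * \<beta> \<le> a" using \<open>0 < a\<close> \<beta> by simp
      ultimately show "\<alpha>min \<le> a * \<beta> \<and> a * \<beta> \<le> \<alpha>hi" using a by (auto simp: \<alpha>min_def)
    qed
    moreover have "f Y \<le> f X + c * \<alpha> * (grad f X \<bullet> G)"
      using while_option_stop[OF loop] by (simp add: Y_eq)
    moreover have "(c * \<alpha>min) * (\<kappa>1 * (stat_measure f r X)\<^sup>2) \<le> (c * \<alpha>) * q"
      using \<open>0 \<le> q\<close> q(2) c pos calculation(1) par(5) by (intro mult_mono) auto
    ultimately show ?thesis using q(1) by (simp add: mult_ac)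
  qed
  moreover have "c * \<alpha>min * \<kappa>1 > 0" using c pos par by simp
  ultimately show ?thesis by (intro that[of "c * \<alpha>min * \<kappa>1"])
qed

lemma ERFD_in_rank_le:
  assumes par: "0 < \<alpha>lo" "\<beta> \<in> {0<..<1}"
    and Y: "Y \<in> ERFD f r \<alpha>lo \<alpha>hi \<beta> c \<kappa>1 \<kappa>2 X"
  shows "Y \<in> rank_le r"
proof -
  obtain \<alpha> \<alpha>\<^sub>0 G where Y_eq: "Y = X + \<alpha> *\<^sub>R G"
    and G: "\<forall>a \<in> {0..\<alpha>hi}. X + a *\<^sub>R G \<in> rank_le r"
    and \<alpha>\<^sub>0: "\<alpha>\<^sub>0 \<in> {\<alpha>lo..\<alpha>hi}"
    and loop: "while_option (\<lambda>a. f (X + a *\<^sub>R G) > f X + c * a * (grad f X \<bullet> G)) (\<lambda>a. a * \<beta>) \<alpha>\<^sub>0 = Some \<alpha>"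
    using Y unfolding ERFD_def by blast
  have "\<alpha> \<in> {0..\<alpha>hi}"
  proof (rule while_option_rule[OF _ loop, where P = "\<lambda>a. a \<in> {0..\<alpha>hi}"])
    show "\<alpha>\<^sub>0 \<in> {0..\<alpha>hi}" using \<alpha>\<^sub>0 par(1) by auto
    fix a assume "a \<in> {0..\<alpha>hi}"
    then show "a * \<beta> \<in> {0..\<alpha>hi}" using par(2) mult_left_le[of \<beta> a] by auto
  qed
  with G show ?thesis by (simp add: Y_eq)
qed

text \<open>
  A descent direction \<open>Z\<close> at \<open>A\<close> that extends to a continuous selection \<open>\<zeta>\<close> bounds the stationarity
  measure away from zero at the points near \<open>A\<close> where \<open>\<zeta>\<close> is tangent. The decrease is then bounded
  below, while \<open>f X\<close> tends to \<open>f A\<close>, so a step from there ends below \<open>f A\<close>. The two cases of the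
  convergence proof differ only in the choice of \<open>\<zeta>\<close>.
\<close>

lemma ERFD_escapes_nonstationary:
  fixes f :: "real ^ 'n ^ 'm \<Rightarrow> real" and A :: "real ^ 'n ^ 'm"
  assumes f: "f differentiable_on UNIV" "locally_lipschitz_gradient f"
    and par: "0 < \<alpha>lo" "\<alpha>lo \<le> \<alpha>hi" "\<beta> \<in> {0<..<1}" "c \<in> {0<..<1}" "0 < \<kappa>1" "0 < \<kappa>2"
    and \<zeta>: "(\<zeta> \<longlongrightarrow> Z) (nhds A)" and descent: "grad f A \<bullet> Z < 0"
  shows "\<forall>\<^sub>F X in nhds A. X \<in> rank_le r \<longrightarrow> \<zeta> X \<in> tangent_cone (rank_le r) X \<longrightarrow>
           (\<forall>Y \<in> ERFD f r \<alpha>lo \<alpha>hi \<beta> c \<kappa>1 \<kappa>2 X. f Y < f A)"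
proof -
  obtain \<eta> where \<eta>: "\<eta> > 0"
    "\<And>X Y. X \<in> cball A 1 \<Longrightarrow> Y \<in> ERFD f r \<alpha>lo \<alpha>hi \<beta> c \<kappa>1 \<kappa>2 X \<Longrightarrow>
       f Y \<le> f X - \<eta> * (stat_measure f r X)\<^sup>2"
    using ERFD_sufficient_decrease[OF f par] by blast
  have "Z \<noteq> 0" using descent by auto
  define s where "s = (- grad f A \<bullet> Z) / norm Z"
  have "s > 0" using descent \<open>Z \<noteq> 0\<close> by (simp add: s_def divide_neg_pos)
  have "((\<lambda>X. (- grad f X \<bullet> \<zeta> X) / norm (\<zeta> X)) \<longlongrightarrow> s) (nhds A)"
    unfolding s_def using \<open>Z \<noteq> 0\<close> by (intro tendsto_intros continuous_grad f(2) \<zeta>) auto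
  then have "\<forall>\<^sub>F X in nhds A. s / 2 < (- grad f X \<bullet> \<zeta> X) / norm (\<zeta> X)"
    using \<open>s > 0\<close> by (intro order_tendstoD(1)) auto
  moreover have "\<forall>\<^sub>F X in nhds A. X \<in> cball A 1"
    unfolding eventually_nhds_metric by (intro exI[of _ 1]) (auto simp: dist_commute)
  moreover have "\<forall>\<^sub>F X in nhds A. f X < f A + \<eta> * (s / 2)\<^sup>2"
  proof -
    have "continuous_on UNIV f" using f(1) by (rule differentiable_imp_continuous_on)
    then have "(f \<longlongrightarrow> f A) (nhds A)"
      by (simp add: continuous_on_eq_continuous_at isCont_def tendsto_nhds_iff)
    then show ?thesis using \<eta>(1) \<open>s > 0\<close> by (intro order_tendstoD(2)) auto
  qed
  ultimately show ?thesis
  proof eventually_elim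
    case (elim X)
    show ?case
    proof (intro impI ballI)
      fix Y assume X: "X \<in> rank_le r" "\<zeta> X \<in> tangent_cone (rank_le r) X"
        and Y: "Y \<in> ERFD f r \<alpha>lo \<alpha>hi \<beta> c \<kappa>1 \<kappa>2 X"
      have "norm (\<zeta> X) > 0" using elim(1) \<open>s > 0\<close> by auto
      then have "(- grad f X \<bullet> \<zeta> X) / norm (\<zeta> X) \<le> stat_measure f r X"
        using inner_le_stat_measure[OF X, of f] by (simp only: pos_divide_le_eq)
      then have "s / 2 < stat_measure f r X"
        by (rule order.strict_trans2[OF elim(1)])
      then have "(s / 2)\<^sup>2 \<le> (stat_measure f r X)\<^sup>2"
        using \<open>s > 0\<close> by (intro power_mono) auto
      then have "\<eta> * (s / 2)\<^sup>2 \<le> \<eta> * (stat_measure f r X)\<^sup>2"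
        using \<eta>(1) by (intro mult_left_mono) auto
      with \<eta>(2)[OF elim(2) Y] elim(3) show "f Y < f A" by linarith
    qed
  qed
qed

lemma tendsto_two_sided:
  fixes A :: "real ^ 'n ^ 'm"
  shows "((\<lambda>X. C ** X + X ** B) \<longlongrightarrow> C ** A + A ** B) (nhds A)"
proof -
  have "linear (\<lambda>X :: real ^ 'n ^ 'm. C ** X + X ** B)"
    by (intro linearI; unfold matrix_eq)
      (simp_all only: matrix_vector_mult_add_rdistrib matrix_vector_right_distrib
        matrix_vector_mult_scaleR scaleR_add_right matrix_vector_mul_assoc[symmetric]
        scaleR_matrix_vector_assoc[symmetric] add_ac simp_thms)
  then have "bounded_linear (\<lambda>X :: real ^ 'n ^ 'm. C ** X + X ** B)"
    by (simp add: linear_conv_bounded_linear)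
  from bounded_linear.tendsto[OF this filterlim_ident] show ?thesis .
qed

section \<open>Non-stationary points repel the ERFDR map\<close>

lemma outer_descent_direction:
  fixes g :: "real ^ 'n ^ 'm"
  assumes "g \<noteq> 0"
  obtains w v where "g \<bullet> outer w v < 0"
proof -
  obtain i where i: "g $ i \<noteq> 0" using assms by (auto simp: vec_eq_iff)
  have "g \<bullet> outer (axis i 1) (- (g $ i)) = (\<Sum>k\<in>UNIV. if k = i then - (g $ i \<bullet> g $ i) else 0)"
    unfolding outer_def inner_vec_def[of g] by (intro sum.cong) (auto simp: axis_def)
  also have "\<dots> < 0" using i by simp
  finally show ?thesis by (rule that)
qed

lemma argmin_setD: "Y \<in> argmin_set f S \<Longrightarrow> Z \<in> S \<Longrightarrow> f Y \<le> f Z"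
  by (auto simp: argmin_set_def is_arg_min_def not_less)

lemma ERFDR_le_ERFD:
  assumes "Y \<in> ERFDR f r \<alpha>lo \<alpha>hi \<beta> c \<kappa>1 \<kappa>2 \<Delta> X"
  obtains X' where "X' \<in> ERFD f r \<alpha>lo \<alpha>hi \<beta> c \<kappa>1 \<kappa>2 X" "f Y \<le> f X'"
  using assms unfolding ERFDR_def by (fastforce dest: argmin_setD split: if_splits)

lemma ERFDR_le_ERFD_reduced:
  assumes "Y \<in> ERFDR f r \<alpha>lo \<alpha>hi \<beta> c \<kappa>1 \<kappa>2 \<Delta> X" "0 < sing_val r X" "sing_val r X \<le> \<Delta>"
  obtains Xhat XR where "Xhat \<in> proj_set (rank_eq (r - 1)) X"
    "XR \<in> ERFD f r \<alpha>lo \<alpha>hi \<beta> c \<kappa>1 \<kappa>2 Xhat" "f Y \<le> f XR"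
  using assms unfolding ERFDR_def by (fastforce dest: argmin_setD)

lemma ERFDR_in_rank_le:
  assumes "0 < \<alpha>lo" "\<beta> \<in> {0<..<1}" and Y: "Y \<in> ERFDR f r \<alpha>lo \<alpha>hi \<beta> c \<kappa>1 \<kappa>2 \<Delta> X"
  shows "Y \<in> rank_le r"
proof -
  have "\<exists>X. Y \<in> ERFD f r \<alpha>lo \<alpha>hi \<beta> c \<kappa>1 \<kappa>2 X"
    using Y unfolding ERFDR_def argmin_set_def is_arg_min_def by (auto split: if_splits)
  then show ?thesis using ERFD_in_rank_le[OF assms(1,2)] by blast
qed

text \<open>
  If \<open>rank A = r\<close>, tangent directions extend continuously to all nearby points, and the plain step
  from \<open>X\<close> suffices. If \<open>rank A < r\<close>, the tangent cone at \<open>A\<close> can be much larger than those at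
  nearby points of rank \<open>r\<close>, but the gradient at \<open>A\<close> is not zero and a fixed rank-one descent direction is
  tangent at all points of rank less than \<open>r\<close>. At a point \<open>X\<close> of rank \<open>r\<close> near \<open>A\<close> the \<open>r\<close>-th
  singular value is positive and at most \<open>norm (X - A)\<close>, which triggers the rank reduction, and the
  second step starts at a point of rank \<open>r - 1\<close> that is still close to \<open>A\<close>.
\<close>

lemma ERFDR_escapes_nonstationary:
  fixes f :: "real ^ 'n ^ 'm \<Rightarrow> real" and A :: "real ^ 'n ^ 'm"
  assumes r: "0 < r"
    and f: "f differentiable_on UNIV" "locally_lipschitz_gradient f"
    and par: "0 < \<alpha>lo" "\<alpha>lo \<le> \<alpha>hi" "\<beta> \<in> {0<..<1}" "c \<in> {0<..<1}" "0 < \<kappa>1" "0 < \<kappa>2"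
    and \<Delta>: "0 < \<Delta>"
    and A: "A \<in> rank_le r" "\<not> B_stationary f r A"
  shows "\<forall>\<^sub>F X in nhds A. X \<in> rank_le r \<longrightarrow>
           (\<forall>\<Delta>'\<ge>\<Delta>. \<forall>Y \<in> ERFDR f r \<alpha>lo \<alpha>hi \<beta> c \<kappa>1 \<kappa>2 \<Delta>' X. f Y < f A)"
proof -
  obtain Z where Z: "Z \<in> tangent_cone (rank_le r) A" "grad f A \<bullet> Z < 0"
    using A by (auto simp: B_stationary_def not_le)
  show ?thesis
  proof (cases "rank A = r")
    case True
    obtain C B where CB: "Z = C ** A + A ** B"
      using kernel_to_range_imp_two_sided[of A Z] tangent_maps_kernel_to_range[OF True Z(1)] by blast
    have "\<forall>\<^sub>F X in nhds A. X \<in> rank_le r \<longrightarrow> C ** X + X ** B \<in> tangent_cone (rank_le r) X \<longrightarrow>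
        (\<forall>Y \<in> ERFD f r \<alpha>lo \<alpha>hi \<beta> c \<kappa>1 \<kappa>2 X. f Y < f A)"
      using tendsto_two_sided[of C B A] Z(2)
      by (intro ERFD_escapes_nonstationary[OF f par]) (simp_all add: CB)
    then show ?thesis
    proof eventually_elim
      case (elim X)
      then show ?case
        by (meson ERFDR_le_ERFD two_sided_in_tangent_cone le_less_trans)
    qed
  next
    case False
    with A(1) have rankA: "rank A < r" by (simp add: rank_le_def)
    have "grad f A \<noteq> 0" using Z(2) by auto
    then obtain w v where wv: "grad f A \<bullet> outer w v < 0"
      by (rule outer_descent_direction)
    obtain e where e: "e > 0" "\<And>X Y. dist X A < e \<Longrightarrow> rank X < r \<Longrightarrow>
        Y \<in> ERFD f r \<alpha>lo \<alpha>hi \<beta> c \<kappa>1 \<kappa>2 X \<Longrightarrow> f Y < f A"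
      using ERFD_escapes_nonstationary[OF f par tendsto_const wv, of r] outer_in_tangent_cone[of _ r w v]
      unfolding eventually_nhds_metric by (auto simp: rank_le_def)
    show ?thesis
      unfolding eventually_nhds_metric
    \<comment> \<open>The rank-reduced point is at most twice as far from \<open>A\<close> as \<open>X\<close> is; hence \<open>e / 2\<close>.\<close>
    proof (intro exI[of _ "min (e / 2) \<Delta>"] conjI allI impI ballI)
      show "0 < min (e / 2) \<Delta>" using e(1) \<Delta> by simp
    next
      fix X \<Delta>' Y
      assume X: "dist X A < min (e / 2) \<Delta>" "X \<in> rank_le r" and \<Delta>': "\<Delta> \<le> \<Delta>'"
        and Y: "Y \<in> ERFDR f r \<alpha>lo \<alpha>hi \<beta> c \<kappa>1 \<kappa>2 \<Delta>' X"
      show "f Y < f A"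
      proof (cases "rank X < r")
        case True
        obtain X' where "X' \<in> ERFD f r \<alpha>lo \<alpha>hi \<beta> c \<kappa>1 \<kappa>2 X" "f Y \<le> f X'"
          using ERFDR_le_ERFD[OF Y] .
        moreover have "dist X A < e" using X(1) e(1) by simp
        ultimately show ?thesis using e(2)[OF _ True] by force
      next
        case False
        with X(2) have rankX: "rank X = r" by (simp add: rank_le_def)
        have "0 < sing_val r X" using sing_val_pos[OF r, of X] rankX by simp
        moreover have "sing_val r X \<le> \<Delta>'"
          using sing_val_le_dist_lower_rank[OF rankA, of X] rankX X(1) \<Delta>' by (simp add: dist_norm)
        ultimately obtain Xhat XR where XR: "Xhat \<in> proj_set (rank_eq (r - 1)) X"
          "XR \<in> ERFD f r \<alpha>lo \<alpha>hi \<beta> c \<kappa>1 \<kappa>2 Xhat" "f Y \<le> f XR"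
          using ERFDR_le_ERFD_reduced[OF Y] by blast
        obtain B where B: "rank B = r - 1" "norm (X - B) \<le> norm (X - A)"
          using rank_reduce_near[of A X] rankA rankX by auto
        have "norm (X - Xhat) \<le> norm (X - B)"
          using XR(1) B(1) unfolding proj_set_def by (auto dest: argmin_setD simp: rank_eq_def)
        then have "dist Xhat A < e"
          using B(2) X(1) norm_triangle_ineq[of "Xhat - X" "X - A"]
          by (simp add: dist_norm norm_minus_commute)
        moreover have "rank Xhat < r"
          using XR(1) r by (simp add: proj_set_def argmin_set_def is_arg_min_def rank_eq_def)
        ultimately have "f XR < f A" using e(2) XR(2) by blast
        with XR(3) show ?thesis by simp
      qed
    qed
  qed
qed

lemma ERFDR_nonincreasing:
  fixes f :: "real ^ 'n ^ 'm \<Rightarrow> real"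
  assumes f: "f differentiable_on UNIV" "locally_lipschitz_gradient f"
    and par: "0 < \<alpha>lo" "\<alpha>lo \<le> \<alpha>hi" "\<beta> \<in> {0<..<1}" "c \<in> {0<..<1}" "0 < \<kappa>1" "0 < \<kappa>2"
    and Y: "Y \<in> ERFDR f r \<alpha>lo \<alpha>hi \<beta> c \<kappa>1 \<kappa>2 \<Delta> X"
  shows "f Y \<le> f X"
proof -
  obtain X' where X': "X' \<in> ERFD f r \<alpha>lo \<alpha>hi \<beta> c \<kappa>1 \<kappa>2 X" "f Y \<le> f X'"
    using ERFDR_le_ERFD[OF Y] .
  obtain \<eta> where "\<eta> > 0" "\<And>W Y. W \<in> cball X 1 \<Longrightarrow> Y \<in> ERFD f r \<alpha>lo \<alpha>hi \<beta> c \<kappa>1 \<kappa>2 W \<Longrightarrow>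
       f Y \<le> f W - \<eta> * (stat_measure f r W)\<^sup>2"
    using ERFD_sufficient_decrease[OF f par] by blast
  from this(2)[OF _ X'(1)] \<open>\<eta> > 0\<close> have "f X' \<le> f X - \<eta> * (stat_measure f r X)\<^sup>2" by simp
  moreover have "0 \<le> \<eta> * (stat_measure f r X)\<^sup>2" using \<open>\<eta> > 0\<close> by simp
  ultimately show ?thesis using X'(2) by linarith
qed

section \<open>Convergence of the algorithm\<close>

theorem theorem4p2:
  fixes f :: "real ^ 'n ^ 'm \<Rightarrow> real"
    and r :: nat
    and \<alpha>lo \<alpha>hi \<beta> c \<kappa>1 \<kappa>2 \<Delta> :: real
    and N :: enat
    and X :: "nat \<Rightarrow> real ^ 'n ^ 'm"
  assumes "0 < r" and "r < min CARD('m) CARD('n)"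
    and "f differentiable_on UNIV" and "locally_lipschitz_gradient f"
    and "0 < \<alpha>lo" and "\<alpha>lo \<le> \<alpha>hi"
    and "\<beta> \<in> {0<..<1}" and "c \<in> {0<..<1}"
    and "\<kappa>1 \<in> {0<..1/2}" and "\<kappa>2 \<in> {0<..1}"
    and "0 < \<Delta>"
    and "ERFDR_sequence f r \<alpha>lo \<alpha>hi \<beta> c \<kappa>1 \<kappa>2 \<Delta> N X"
  shows "(\<forall>k. N = enat k \<longrightarrow> B_stationary f r (X k)) \<and>
         (N = \<infinity> \<longrightarrow> (\<forall>A. accumulation_point X A \<longrightarrow> B_stationary f r A))"
proof -
  note f = assms(3,4)
  have par: "0 < \<alpha>lo" "\<alpha>lo \<le> \<alpha>hi" "\<beta> \<in> {0<..<1}" "c \<in> {0<..<1}" "0 < \<kappa>1" "0 < \<kappa>2"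
    using assms by auto
  have X0: "X 0 \<in> rank_le r"
    and stop: "\<And>k. N = enat k \<Longrightarrow> \<not> stat_measure f r (X k) > 0"
    and step: "\<And>i. enat i < N \<Longrightarrow> \<exists>\<Delta>'\<ge>\<Delta>. X (Suc i) \<in> ERFDR f r \<alpha>lo \<alpha>hi \<beta> c \<kappa>1 \<kappa>2 \<Delta>' (X i)"
    using assms(12) unfolding ERFDR_sequence_def by blast+
  have in_rank: "X i \<in> rank_le r" if "enat i \<le> N" for i
  proof (cases i)
    case (Suc j)
    then have "enat j < N" using that by (metis Suc_ile_eq)
    with step Suc show ?thesis using ERFDR_in_rank_le[OF par(1,3)] by blast
  qed (simp add: X0)
  show ?thesis
  proof (intro conjI allI impI)
    fix k assume "N = enat k"
    then show "B_stationary f r (X k)"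
      using B_stationary_if_stat_measure_zero in_rank stop by blast
  next
    fix A assume N: "N = \<infinity>" and "accumulation_point X A"
    then obtain \<phi> where \<phi>: "strict_mono \<phi>" "(X \<circ> \<phi>) \<longlonglongrightarrow> A"
      by (auto simp: accumulation_point_def)
    have rank: "X i \<in> rank_le r" for i using in_rank N by simp
    have A: "A \<in> rank_le r"
      by (rule Lim_in_closed_set[OF closed_rank_le _ sequentially_bot \<phi>(2)]) (simp add: rank)
    have "f (X (Suc i)) \<le> f (X i)" for i
      using step[of i] N ERFDR_nonincreasing[OF f par] by auto
    then have decr: "f (X j) \<le> f (X i)" if "i \<le> j" for i j
      using that by (rule lift_Suc_antimono_le)
    have "isCont f A"
      using differentiable_imp_continuous_on[OF f(1)] by (simp add: continuous_on_eq_continuous_at)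
    then have lim: "(\<lambda>j. f (X (\<phi> j))) \<longlonglongrightarrow> f A"
      using isCont_tendsto_compose[OF _ \<phi>(2)] by (simp add: o_def)
    have lower: "f A \<le> f (X i)" for i
      using lim
      by (rule LIMSEQ_le_const2) (meson decr le_trans strict_mono_imp_increasing \<phi>(1))
    show "B_stationary f r A"
    proof (rule ccontr)
      assume "\<not> B_stationary f r A"
      from eventually_compose_filterlim[OF
          ERFDR_escapes_nonstationary[OF assms(1) f par assms(11) A this] \<phi>(2)]
      obtain j where "\<forall>\<Delta>'\<ge>\<Delta>. \<forall>Y \<in> ERFDR f r \<alpha>lo \<alpha>hi \<beta> c \<kappa>1 \<kappa>2 \<Delta>' (X (\<phi> j)). f Y < f A"
        using rank eventually_happens'[OF sequentially_bot] by (force simp: o_def)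
      moreover obtain \<Delta>' where "\<Delta>' \<ge> \<Delta>" "X (Suc (\<phi> j)) \<in> ERFDR f r \<alpha>lo \<alpha>hi \<beta> c \<kappa>1 \<kappa>2 \<Delta>' (X (\<phi> j))"
        using step[of "\<phi> j"] N by auto
      ultimately have "f (X (Suc (\<phi> j))) < f A" by blast
      with lower[of "Suc (\<phi> j)"] show False by simp
    qed
  qed
qed

end
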